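(* Let $(\{T_n\},\{t_n\},\{a_n\})$ be a Warlimont triple such that $\log(a_n)=O(n)$, let $R$ be a positive integer, and let $\{\beta_n\}$ be defined by $\beta_0=1$ and $\beta_n=-\sum_{s=0}^{n-1}\beta_sT_{n-s}$ for $n\ge1$. Then the following are equivalent (all asymptotics as $n\to\infty$): 1) $T_{n-1}=o(T_n)$ and $\sum_{s=R}^{n-R}T_sT_{n-s}=O(T_{n-R})$; 2) $T_{n-1}=o(T_n)$ and $a_1t_n=\sum_{s=0}^{R-1}\beta_sT_{n-s}+O(T_{n-R})$; 3) $t_{n-1}=o(t_n)$ and $T_n=a_1\sum_{s=0}^{R-1}T_st_{n-s}+O(t_{n-R})$; 4) $t_{n-1}=o(t_n)$ and $\sum_{s=R}^{n-R}t_st_{n-s}=O(t_{n-R})$.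
   Context: A Warlimont triple is a triple $(\{T_n\}_{n\ge0},\{t_n\}_{n\ge1},\{a_n\}_{n\ge0})$ of sequences of non-negative real numbers satisfying the identity of formal power series \[ \sum_{n=0}^\infty T_nx^n=\prod_{m=1}^\infty\Big(\sum_{k=0}^\infty a_kx^{km}\Big)^{t_m}, \] and such that (i) $T_0=a_0=1$; (ii) $a_1>0$; (iii) $t_m\in\mathbb Z$ for all $m$ and $t_m>0$ for all but finitely many $m$. *)

theory Defs
  imports "HOL-Analysis.Analysis"
begin

(* The infinite product converges in the fps_X-adic topology of real fps; its m-th factor is
   the one of index Suc m. The composition Abs_fps a oo fps_X ^ m is sum_k a_k x^(k*m), and
   nat (floor (t m)) is t m itself as an exponent, because t m is a non-negative integer.
   The value t 0 is irrelevant. *)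
definition warlimont_triple :: "(nat \<Rightarrow> real) \<Rightarrow> (nat \<Rightarrow> real) \<Rightarrow> (nat \<Rightarrow> real) \<Rightarrow> bool" where
  "warlimont_triple T t a \<longleftrightarrow>
     (\<forall>n. T n \<ge> 0) \<and> (\<forall>m\<ge>1. t m \<ge> 0) \<and> (\<forall>n. a n \<ge> 0) \<and>
     T 0 = 1 \<and> a 0 = 1 \<and> a 1 > 0 \<and>
     (\<forall>m\<ge>1. t m \<in> \<int>) \<and> finite {m. m \<ge> 1 \<and> \<not> t m > 0} \<and>
     (\<lambda>m. (Abs_fps a oo fps_X ^ Suc m) ^ nat \<lfloor>t (Suc m)\<rfloor>) has_prod Abs_fps T"

fun beta :: "(nat \<Rightarrow> real) \<Rightarrow> nat \<Rightarrow> real" where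
  "beta T n = (if n = 0 then 1 else - (\<Sum>s=0..<n. beta T s * T (n - s)))"

declare beta.simps [simp del]

end

(* Write D = x d/dx. Taking logarithmic derivatives in the product formula gives
   n T_n = sum_{s <= n} s h_s T_{n-s}, where s h_s = sum_{m | s} m t_m c_{s/m} and c = D A / A.
   As c_k grows at most exponentially, h_n = a_1 t_n + O(L^n sum_{m <= n/2} t_m), and the error is
   O(w (n - R)) as soon as w (n - 1) = o(w n), for w = T or w = t (note a_1 t_n <= T_n). So t may be
   replaced by h / a_1 throughout.
   If T and h are O(w), then for e_n = T_n - sum_{s < R} T_s h_{n-s} the recurrence reads
   n e_n = X_n + sum_{1 <= j < R} j h_j e_{n-j} + O(w (n - R)) with X_n = sum_{s=R}^{n-R} s h_s T_{n-s},
   so e_n = O(w (n - R)) iff X_n = O(n w (n - R)). The symmetry s <-> n - s turns X_n into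
   (n/2) sum_{s=R}^{n-R} w_s w_{n-s} up to constants when T, h and w are comparable. Finally, e_n
   and h_n - sum_{s < R} beta_s T_{n-s} are exchanged by convolution with beta, the inverse of T. *)

theory Submission
  imports Defs "HOL-Computational_Algebra.Formal_Laurent_Series"
begin

unbundle no vec_syntax

section \<open>Logarithmic derivatives of formal power series\<close>

text \<open>Relational form of \<open>x F'/F = c\<close>, so that no division of power series is involved.\<close>

definition has_logderiv :: "real fps \<Rightarrow> real fps \<Rightarrow> bool" where
  "has_logderiv F c \<longleftrightarrow> fps_X * fps_deriv F = F * c"

lemma has_logderiv_1: "has_logderiv 1 0"
  by (simp add: has_logderiv_def)

lemma has_logderiv_mult:
  assumes "has_logderiv F c" "has_logderiv G d"
  shows "has_logderiv (F * G) (c + d)"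
proof -
  have "fps_X * fps_deriv (F * G) = (fps_X * fps_deriv F) * G + F * (fps_X * fps_deriv G)"
    by (simp add: algebra_simps)
  also have "\<dots> = F * G * (c + d)"
    using assms by (simp add: has_logderiv_def algebra_simps)
  finally show ?thesis by (simp add: has_logderiv_def)
qed

lemma has_logderiv_power:
  assumes "has_logderiv F c"
  shows "has_logderiv (F ^ k) (of_nat k * c)"
proof (induction k)
  case 0
  then show ?case by (simp add: has_logderiv_1)
next
  case (Suc k)
  show ?case using has_logderiv_mult[OF assms Suc.IH] by (simp add: algebra_simps)
qed

lemma has_logderiv_prod:
  assumes "finite I" "\<And>i. i \<in> I \<Longrightarrow> has_logderiv (F i) (c i)"
  shows "has_logderiv (\<Prod>i\<in>I. F i) (\<Sum>i\<in>I. c i)"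
  using assms by (induction I rule: finite_induct) (auto simp: has_logderiv_1 has_logderiv_mult)

text \<open>Chain rule: for Y = x^m one has x Y' = m Y, so x d/dx of F(x^m) is m times (x F')(x^m).
  The exponent is \<open>Suc m\<close> because composition needs a vanishing constant term.\<close>

lemma has_logderiv_compose_X_power:
  assumes "has_logderiv F c"
  shows "has_logderiv (F oo fps_X ^ Suc m) (of_nat (Suc m) * (c oo fps_X ^ Suc m))"
proof -
  let ?Y = "fps_X ^ Suc m :: real fps"
  have Y0: "?Y $ 0 = 0" by simp
  have "fps_X * fps_deriv (F oo ?Y) = fps_X * ((fps_deriv F oo ?Y) * fps_deriv ?Y)"
    by (subst fps_compose_deriv[OF Y0]) simp
  also have "\<dots> = of_nat (Suc m) * (?Y * (fps_deriv F oo ?Y))"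
  proof -
    have "fps_deriv ?Y = of_nat (Suc m) * fps_X ^ m"
      by (simp add: fps_deriv_power fps_of_nat flip: fps_of_nat del: of_nat_Suc power_Suc)
    thus ?thesis by (simp only: power_Suc mult_ac)
  qed
  also have "?Y * (fps_deriv F oo ?Y) = (fps_X * fps_deriv F) oo ?Y"
    by (subst fps_compose_mult_distrib[OF Y0]) (simp only: fps_X_fps_compose_startby0[OF Y0])
  also have "\<dots> = (F oo ?Y) * (c oo ?Y)"
    using assms by (simp add: has_logderiv_def fps_compose_mult_distrib[OF Y0] del: power_Suc)
  finally show ?thesis by (simp add: has_logderiv_def algebra_simps del: power_Suc)
qed

lemma has_logderiv_nth:
  assumes "has_logderiv F c"
  shows "real n * F $ n = (\<Sum>s=0..n. c $ s * F $ (n - s))"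
proof -
  have "real n * F $ n = (fps_X * fps_deriv F) $ n"
    by (cases n) simp_all
  also have "\<dots> = (c * F) $ n"
    using assms by (simp add: has_logderiv_def mult.commute)
  finally show ?thesis by (simp add: fps_mult_nth)
qed

text \<open>Strong induction on c_n = n F_n - sum_{s<n} c_s F_{n-s}. The base 3 comes from sum_{s<n}
  3^s + n <= 3^n, which absorbs both the convolution and the factor n.\<close>

lemma logderiv_coeff_bound:
  assumes log: "has_logderiv F c" and F0: "F $ 0 = 1" and c0: "c $ 0 = 0"
    and K: "K \<ge> 1" "\<And>n. \<bar>F $ n\<bar> \<le> K ^ n"
  shows "\<bar>c $ n\<bar> \<le> (3 * K) ^ n"
proof (induction n rule: less_induct)
  case (less n)
  have three: "(\<Sum>s=0..<n. 3 ^ s) + real n \<le> (3::real) ^ n" for n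
  proof (induction n)
    case (Suc n)
    have "1 \<le> (3::real) ^ n" by (rule one_le_power) simp
    with Suc show ?case unfolding sum.atLeast0_lessThan_Suc power_Suc of_nat_Suc by linarith
  qed simp
  have "real n * F $ n = c $ n + (\<Sum>s=0..<n. c $ s * F $ (n - s))"
    using has_logderiv_nth[OF log, of n] F0 by (simp add: atLeastLessThanSuc_atLeastAtMost[symmetric])
  hence "\<bar>c $ n\<bar> \<le> \<bar>real n * F $ n\<bar> + \<bar>\<Sum>s=0..<n. c $ s * F $ (n - s)\<bar>"
    by linarith
  also have "\<bar>\<Sum>s=0..<n. c $ s * F $ (n - s)\<bar> \<le> (\<Sum>s=0..<n. (3 * K) ^ s * K ^ (n - s))"
    using less.IH K by (intro order.trans[OF sum_abs] sum_mono) (auto simp: abs_mult intro!: mult_mono)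
  also have "\<dots> = K ^ n * (\<Sum>s=0..<n. 3 ^ s)"
    unfolding sum_distrib_left
    by (intro sum.cong) (auto simp: power_mult_distrib simp flip: power_add)
  also have "\<bar>real n * F $ n\<bar> \<le> K ^ n * real n"
    using K(2)[of n] by (simp add: abs_mult mult.commute mult_left_mono)
  finally have "\<bar>c $ n\<bar> \<le> K ^ n * ((\<Sum>s=0..<n. 3 ^ s) + real n)"
    by (simp add: algebra_simps)
  also have "\<dots> \<le> K ^ n * 3 ^ n"
    using K(1) by (intro mult_left_mono three) auto
  finally show ?case by (simp add: power_mult_distrib mult.commute)
qed

section \<open>Products of power series with nonnegative coefficients\<close>

lemma fps_mult_nth_superadditive:
  fixes F G :: "real fps"
  assumes "\<And>n. F $ n \<ge> 0" "\<And>n. G $ n \<ge> 0" "F $ 0 = 1" "G $ 0 = 1" "n > 0"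
  shows "(F * G) $ n \<ge> F $ n + G $ n"
proof -
  have "(\<Sum>i\<in>{0,n}. F $ i * G $ (n - i)) \<le> (F * G) $ n"
    unfolding fps_mult_nth using assms by (intro sum_mono2) auto
  thus ?thesis using assms by simp
qed

text \<open>Expand the product and keep only the terms in which one factor supplies x^n and all
  others their constant term 1. The three claims are proved together because the induction step uses
  all of them.\<close>

lemma fps_prod_nth_superadditive:
  fixes F :: "'i \<Rightarrow> real fps"
  assumes "finite I" "\<And>i n. i \<in> I \<Longrightarrow> F i $ n \<ge> 0" "\<And>i. i \<in> I \<Longrightarrow> F i $ 0 = 1"
  shows "(\<forall>n. (\<Prod>i\<in>I. F i) $ n \<ge> 0) \<and> (\<Prod>i\<in>I. F i) $ 0 = 1 \<and>
         (\<forall>n>0. (\<Prod>i\<in>I. F i) $ n \<ge> (\<Sum>i\<in>I. F i $ n))"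
  using assms
proof (induction I rule: finite_induct)
  case empty
  then show ?case by (auto simp: fps_one_nth)
next
  case (insert i I)
  have "(F i * (\<Prod>i\<in>I. F i)) $ n \<ge> 0" for n
    unfolding fps_mult_nth using insert by (intro sum_nonneg mult_nonneg_nonneg) auto
  moreover have "(F i * (\<Prod>i\<in>I. F i)) $ n \<ge> F i $ n + (\<Prod>i\<in>I. F i) $ n" if "n > 0" for n
    using insert that by (intro fps_mult_nth_superadditive) auto
  moreover have "(\<Sum>i\<in>I. F i $ n) \<le> (\<Prod>i\<in>I. F i) $ n" if "n > 0" for n
    using insert that by auto
  moreover have "(F i * (\<Prod>i\<in>I. F i)) $ 0 = 1"
    using insert by simp
  moreover have "(\<Prod>i\<in>insert i I. F i) = F i * (\<Prod>i\<in>I. F i)"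
    "\<And>n. (\<Sum>i\<in>insert i I. F i $ n) = F i $ n + (\<Sum>i\<in>I. F i $ n)"
    using insert.hyps by simp_all
  ultimately show ?case by (simp only:) (meson add_left_mono order.trans)
qed

section \<open>Consequences of the product formula\<close>

definition pow_coeff :: "(nat \<Rightarrow> real) \<Rightarrow> nat \<Rightarrow> real" where
  "pow_coeff a n = (fps_X * fps_deriv (Abs_fps a) * inverse (Abs_fps a)) $ n"

text \<open>With \<open>c = pow_coeff a\<close>, this is the \<open>s\<close>-th coefficient, divided by \<open>s\<close>, of
  \<open>x T'/T = \<Sum>\<^sub>m m t\<^sub>m c(x\<^sup>m)\<close>.\<close>

definition log_coeff :: "(nat \<Rightarrow> real) \<Rightarrow> (nat \<Rightarrow> real) \<Rightarrow> nat \<Rightarrow> real" where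
  "log_coeff t a s = (\<Sum>m | 1 \<le> m \<and> m dvd s \<and> m \<le> s. real m * t m * pow_coeff a (s div m)) / real s"

lemma has_logderiv_pow_coeff:
  assumes "a 0 = 1"
  shows "has_logderiv (Abs_fps a) (Abs_fps (pow_coeff a))"
proof -
  have "Abs_fps (pow_coeff a) = fps_X * fps_deriv (Abs_fps a) * inverse (Abs_fps a)"
    by (simp add: fps_eq_iff pow_coeff_def)
  moreover have "inverse (Abs_fps a) * Abs_fps a = 1"
    using assms by (intro inverse_mult_eq_1) simp
  ultimately show ?thesis by (simp add: has_logderiv_def algebra_simps)
qed

lemma pow_coeff_0: "pow_coeff a 0 = 0"
  by (simp add: pow_coeff_def)

lemma pow_coeff_1: "a 0 = 1 \<Longrightarrow> pow_coeff a 1 = a 1"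
  using has_logderiv_nth[OF has_logderiv_pow_coeff, of a 1] by (simp add: pow_coeff_0)

context
  fixes T t a :: "nat \<Rightarrow> real"
  assumes W: "warlimont_triple T t a"
begin

lemma partial_products_eventually_eq:
  "eventually (\<lambda>N. (\<Prod>m\<le>N. (Abs_fps a oo fps_X ^ Suc m) ^ nat \<lfloor>t (Suc m)\<rfloor>) $ n = T n) sequentially"
proof -
  \<comment> \<open>\<open>has_prod\<close> has a separate clause for products with a zero factor,
    whose value is 0; \<open>T 0 = 1\<close> excludes it, so the partial products really converge to
    T.\<close>
  have "Abs_fps T \<noteq> 0"
    using W by (auto simp: fps_eq_iff warlimont_triple_def intro!: exI[of _ 0])
  hence "(\<lambda>N. \<Prod>m\<le>N. (Abs_fps a oo fps_X ^ Suc m) ^ nat \<lfloor>t (Suc m)\<rfloor>) \<longlonglongrightarrow> Abs_fps T"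
    using W by (auto simp: warlimont_triple_def has_prod_def raw_has_prod_def)
  thus ?thesis by (simp add: tendsto_fps_iff)
qed

lemma of_nat_exponent: "real (nat \<lfloor>t (Suc m)\<rfloor>) = t (Suc m)"
  using W by (auto simp: warlimont_triple_def elim!: Ints_cases)

text \<open>For fixed n some finite partial product agrees with T up to degree n, so the product
  rule for finitely many factors suffices and no infinite series of series has to be
  differentiated.\<close>

lemma logderiv_recurrence: "real n * T n = (\<Sum>s=1..n. real s * log_coeff t a s * T (n - s))"
proof -
  define F where "F = (\<lambda>N. \<Prod>m\<le>N. (Abs_fps a oo fps_X ^ Suc m) ^ nat \<lfloor>t (Suc m)\<rfloor>)"
  define C where "C = (\<lambda>N. \<Sum>m\<le>N. of_nat (nat \<lfloor>t (Suc m)\<rfloor>) *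
    (of_nat (Suc m) * (Abs_fps (pow_coeff a) oo fps_X ^ Suc m)))"
  have a0: "a 0 = 1" using W by (simp add: warlimont_triple_def)
  have log: "has_logderiv (F N) (C N)" for N
    unfolding F_def C_def
    by (intro has_logderiv_prod has_logderiv_power has_logderiv_compose_X_power has_logderiv_pow_coeff a0)
       simp
  have "eventually (\<lambda>N. \<forall>k\<in>{..n}. F N $ k = T k) sequentially"
    unfolding F_def using partial_products_eventually_eq
    by (intro eventually_ball_finite) auto
  hence "eventually (\<lambda>N. N \<ge> n \<and> (\<forall>k\<in>{..n}. F N $ k = T k)) sequentially"
    using eventually_ge_at_top[of n] by eventually_elim auto
  then obtain N where N: "N \<ge> n" "\<And>k. k \<le> n \<Longrightarrow> F N $ k = T k"
    by (auto dest!: eventually_happens'[OF sequentially_bot])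
  have C: "C N $ s = real s * log_coeff t a s" if "s \<in> {1..n}" for s
  proof -
    have "C N $ s = (\<Sum>m\<le>N. if Suc m dvd s then real (Suc m) * t (Suc m) * pow_coeff a (s div Suc m) else 0)"
      unfolding C_def fps_sum_nth
      by (intro sum.cong refl, simp only: fps_mult_of_nat_nth of_nat_exponent fps_nth_compose_X_power)
         simp
    also have "\<dots> = (\<Sum>m\<in>{1..Suc N}. if m dvd s then real m * t m * pow_coeff a (s div m) else 0)"
      by (rule sum.reindex_bij_witness[of _ "\<lambda>m. m - 1" Suc]) auto
    \<comment> \<open>As s <= n <= N, every divisor m of s lies in \<open>{1..Suc N}\<close>, so no
      term of the divisor sum is lost.\<close>
    also have "\<dots> = (\<Sum>m | 1 \<le> m \<and> m dvd s \<and> m \<le> s. real m * t m * pow_coeff a (s div m))"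
      using that N(1) by (intro sum.mono_neutral_cong_right) (auto dest: dvd_imp_le)
    finally show ?thesis using that by (simp add: log_coeff_def)
  qed
  have "C N $ 0 = 0"
    unfolding C_def fps_sum_nth by (simp only: fps_mult_of_nat_nth fps_nth_compose_X_power) (simp add: pow_coeff_0)
  hence "real n * F N $ n = (\<Sum>s=1..n. C N $ s * F N $ (n - s))"
    using has_logderiv_nth[OF log, of n N] by (simp add: sum.atLeast_Suc_atMost)
  also have "\<dots> = (\<Sum>s=1..n. real s * log_coeff t a s * T (n - s))"
    using C N by (intro sum.cong) auto
  finally show ?thesis using N by simp
qed

text \<open>The factor in x^n alone contributes at least t_n a_1 to the coefficient of x^n, and by
  superadditivity the other factors cannot lower it.\<close>

lemma a1_t_le_T:
  assumes "n \<ge> 1"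
  shows "a 1 * t n \<le> T n"
proof -
  define A where "A = (\<lambda>m. Abs_fps a oo fps_X ^ Suc m)"
  have A: "A m $ k \<ge> 0" "A m $ 0 = 1" for m k
    using W by (auto simp: A_def fps_nth_compose_X_power warlimont_triple_def simp del: power_Suc)
  define P where "P = (\<lambda>m. A m ^ nat \<lfloor>t (Suc m)\<rfloor>)"
  \<comment> \<open>A power is a product over a constant family with \<open>t (Suc m)\<close>
    members, so superadditivity yields that multiple of a single coefficient.\<close>
  have P: "P m $ k \<ge> 0" "P m $ 0 = 1" "k > 0 \<Longrightarrow> P m $ k \<ge> t (Suc m) * A m $ k" for m k
    using fps_prod_nth_superadditive[of "{..<nat \<lfloor>t (Suc m)\<rfloor>}" "\<lambda>_. A m"] A
    by (simp_all add: P_def of_nat_exponent)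
  have "eventually (\<lambda>N. n \<le> N \<and> (\<Prod>m\<le>N. P m) $ n = T n) sequentially"
    using eventually_ge_at_top partial_products_eventually_eq
    unfolding P_def A_def by (rule eventually_conj)
  then obtain N where N: "n \<le> N" "(\<Prod>m\<le>N. P m) $ n = T n"
    using eventually_happens' sequentially_bot by blast
  \<comment> \<open>\<open>A (n - 1)\<close> is the series in x^n, whose coefficient at x^n is
    \<open>a 1\<close>.\<close>
  have "a 1 * t n = t n * A (n - 1) $ n"
    using assms by (simp add: A_def fps_nth_compose_X_power del: power_Suc)
  also have "\<dots> \<le> P (n - 1) $ n"
    using P(3)[of n "n - 1"] assms by simp
  also have "\<dots> \<le> (\<Sum>m\<le>N. P m $ n)"
    using N(1) by (intro member_le_sum P) auto
  also have "\<dots> \<le> (\<Prod>m\<le>N. P m) $ n"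
    using fps_prod_nth_superadditive[of "{..N}" P] P assms by auto
  finally show ?thesis using N by simp
qed

text \<open>The divisor m = n gives exactly a_1 t_n. Every other divisor is at most n/2, carries a
  weight m/n <= 1, and its coefficient c_{n/m} is at most L^n in absolute value.\<close>

lemma log_coeff_diff_le:
  assumes L: "\<And>k. \<bar>pow_coeff a k\<bar> \<le> L ^ k" "L \<ge> 1" and n: "n \<ge> 1"
  shows "\<bar>log_coeff t a n - a 1 * t n\<bar> \<le> L ^ n * (\<Sum>m=1..n div 2. t m)"
proof -
  have t: "t m \<ge> 0" if "m \<ge> 1" for m using W that by (auto simp: warlimont_triple_def)
  have a0: "a 0 = 1" using W by (simp add: warlimont_triple_def)
  let ?D = "{m. 1 \<le> m \<and> m dvd n \<and> m < n}"
  let ?f = "\<lambda>m. real m * t m * pow_coeff a (n div m)"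
  have "{m. 1 \<le> m \<and> m dvd n \<and> m \<le> n} = insert n ?D" using n by auto
  hence "log_coeff t a n = (?f n + (\<Sum>m\<in>?D. ?f m)) / real n"
    by (simp add: log_coeff_def)
  hence eq: "log_coeff t a n - a 1 * t n = (\<Sum>m\<in>?D. ?f m) / real n"
    using n pow_coeff_1[of a] a0 by (simp add: field_simps)
  have half: "m \<in> {1..n div 2}" if m: "m \<in> ?D" for m
  proof -
    obtain k where k: "n = m * k" using m by auto
    have "k \<noteq> 0" "k \<noteq> 1" using m k n by auto
    hence "k \<ge> 2" by simp
    hence "m * 2 \<le> n" using k by simp
    thus ?thesis using m by auto
  qed
  have "\<bar>\<Sum>m\<in>?D. ?f m\<bar> \<le> (\<Sum>m\<in>?D. real n * (L ^ n * t m))"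
  proof (intro order.trans[OF sum_abs] sum_mono)
    fix m assume m: "m \<in> ?D"
    have "\<bar>pow_coeff a (n div m)\<bar> \<le> L ^ n"
      using L(1)[of "n div m"] power_increasing[OF _ L(2), of "n div m" n] by auto
    hence "real m * (t m * \<bar>pow_coeff a (n div m)\<bar>) \<le> real n * (t m * L ^ n)"
      using m t[of m] L(2) by (intro mult_mono mult_left_mono) auto
    thus "\<bar>?f m\<bar> \<le> real n * (L ^ n * t m)"
      using m t[of m] by (simp add: abs_mult mult_ac)
  qed
  also have "\<dots> \<le> (\<Sum>m=1..n div 2. real n * (L ^ n * t m))"
    using half t L(2) by (intro sum_mono2) auto
  also have "\<dots> = real n * (L ^ n * (\<Sum>m=1..n div 2. t m))"
    by (simp add: sum_distrib_left)
  finally show ?thesis using n unfolding eq abs_divide by (simp add: divide_le_eq mult.commute)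
qed

lemma pow_coeff_exp_bound:
  assumes "(\<lambda>n. ln (a n)) \<in> O(\<lambda>n. real n)"
  obtains L where "L \<ge> 1" "\<And>k. \<bar>pow_coeff a k\<bar> \<le> L ^ k"
proof -
  have a: "a n \<ge> 0" "a 0 = 1" for n using W by (auto simp: warlimont_triple_def)
  obtain C where C: "C > 0" "eventually (\<lambda>n. \<bar>ln (a n)\<bar> \<le> C * real n) sequentially"
    using assms by (auto elim!: landau_o.bigE)
  then obtain N where N: "\<And>n. n \<ge> N \<Longrightarrow> \<bar>ln (a n)\<bar> \<le> C * real n"
    by (auto simp: eventually_at_top_linorder)
  \<comment> \<open>\<open>exp C\<close> dominates where the logarithmic bound holds, the finite sum
    covers the indices below N, and the 1 ensures K >= 1. Terms with \<open>a n = 0\<close> satisfy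
    a_n <= K^n trivially.\<close>
  define K where "K = exp C + 1 + (\<Sum>n<N. a n)"
  have K: "K \<ge> 1" "K \<ge> exp C" using a by (auto simp: K_def intro!: add_nonneg_nonneg sum_nonneg)
  have "a n \<le> K ^ n" for n
  proof (cases "n \<ge> N \<or> n = 0")
    case False
    have "a n \<le> (\<Sum>n<N. a n)" using False a by (intro member_le_sum) auto
    hence "a n \<le> K" by (simp add: K_def add_increasing)
    also have "K \<le> K ^ n" using K False by (intro self_le_power) auto
    finally show ?thesis .
  next
    case True
    show ?thesis
    proof (cases "a n = 0 \<or> n = 0")
      case False
      hence "a n = exp (ln (a n))" using a(1)[of n] by simp
      also have "\<dots> \<le> exp (real n * C)" using N[of n] True False by (simp add: mult.commute)
      also have "\<dots> = exp C ^ n" by (rule exp_of_nat_mult)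
      also have "\<dots> \<le> K ^ n" using K by (intro power_mono) auto
      finally show ?thesis .
    qed (use a K in auto)
  qed
  hence "\<bar>pow_coeff a k\<bar> \<le> (3 * K) ^ k" for k
    using logderiv_coeff_bound[OF has_logderiv_pow_coeff, of a K k] K a by (simp add: pow_coeff_0)
  thus ?thesis using K by (intro that[of "3 * K"]) auto
qed

end

section \<open>Sequences with \<open>w (n - 1) = o(w n)\<close>\<close>

text \<open>Instantiated with both \<open>T\<close> and \<open>t\<close>. Positivity is asked only
  eventually, since finitely many of their terms may vanish.\<close>

locale fast_growing =
  fixes w :: "nat \<Rightarrow> real"
  assumes eventually_pos: "eventually (\<lambda>n. w n > 0) sequentially"
    and ratio: "(\<lambda>n. w (n - 1)) \<in> o(w)"
begin

lemma shift_smallo: "(\<lambda>n. w (n - Suc k)) \<in> o(\<lambda>n. w (n - k))"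
  using landau_o.small.compose[OF ratio filterlim_minus_const_nat_at_top[of k]] by simp

lemma shift_bigo: "i \<le> k \<Longrightarrow> (\<lambda>n. w (n - k)) \<in> O(\<lambda>n. w (n - i))"
  by (induction k rule: dec_induct)
     (auto intro: landau_o.big_trans[OF landau_o.small_imp_big[OF shift_smallo]])

lemma bigo_weaken:
  assumes "f \<in> O(\<lambda>n. w (n - k))" "i \<le> k"
  shows "f \<in> O(\<lambda>n. w (n - i))"
  using landau_o.big_trans[OF assms(1) shift_bigo[OF assms(2)]] .

lemma bigo_shift:
  assumes "f \<in> O(\<lambda>n. w (n - k))" "i \<le> k + j"
  shows "(\<lambda>n. f (n - j)) \<in> O(\<lambda>n. w (n - i))"
proof -
  have "(\<lambda>n. f (n - j)) \<in> O(\<lambda>n. w (n - j - k))"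
    by (rule landau_o.big.compose[OF assms(1) filterlim_minus_const_nat_at_top])
  hence "(\<lambda>n. f (n - j)) \<in> O(\<lambda>n. w (n - (k + j)))" by (simp add: add.commute)
  thus ?thesis by (rule bigo_weaken) fact
qed

lemma bigo_shift0: "f \<in> O(w) \<Longrightarrow> i \<le> j \<Longrightarrow> (\<lambda>n. f (n - j)) \<in> O(\<lambda>n. w (n - i))"
  using bigo_shift[of f 0 i j] by simp

lemma eventually_ratio_ge: "eventually (\<lambda>n. B * w (n - 1) \<le> w n) sequentially"
proof -
  \<comment> \<open>\<open>\<bar>B\<bar> + 1\<close> makes the constant positive for every real
    B.\<close>
  have "eventually (\<lambda>n. norm (w (n - 1)) \<le> (1 / (\<bar>B\<bar> + 1)) * norm (w n)) sequentially"
    by (rule landau_o.smallD[OF ratio]) simp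
  thus ?thesis using eventually_pos
  proof eventually_elim
    case (elim n)
    hence "\<bar>w (n - 1)\<bar> * (\<bar>B\<bar> + 1) \<le> w n" by (simp add: field_simps)
    moreover have "B * w (n - 1) \<le> \<bar>B\<bar> * \<bar>w (n - 1)\<bar>"
      by (metis abs_ge_self abs_mult)
    moreover have "\<bar>B\<bar> * \<bar>w (n - 1)\<bar> \<le> \<bar>w (n - 1)\<bar> * (\<bar>B\<bar> + 1)"
      by (simp add: algebra_simps)
    ultimately show ?case by linarith
  qed
qed

text \<open>Such a w outgrows every exponential: the partial sum up to n/2 is comparable with its
  last term, and from there to n - R there are about n/2 steps, each multiplying w by at least B,
  which pays for L^n.\<close>

lemma exp_times_half_sum_bigo:
  "(\<lambda>n. L ^ n * (\<Sum>m=1..n div 2. w m)) \<in> O(\<lambda>n. w (n - R))"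
proof -
  \<comment> \<open>The square matches L^n against only n/2 steps; the factor 2 makes w at least
    double, which controls the partial sums.\<close>
  define B where "B = 2 * (\<bar>L\<bar> + 1)\<^sup>2"
  have sq: "(\<bar>L\<bar> + 1)\<^sup>2 \<ge> 1" by simp
  have B: "B \<ge> 2" using sq by (simp add: B_def del: one_le_power)
  obtain N where N: "\<And>n. n \<ge> N \<Longrightarrow> w n > 0 \<and> B * w (n - 1) \<le> w n"
    using eventually_conj[OF eventually_pos eventually_ratio_ge[of B]]
    by (auto simp: eventually_at_top_linorder)
  have grow: "w (m + k) \<ge> B ^ k * w m" if "m \<ge> N" for m k
  proof (induction k)
    case (Suc k)
    have "B * (B ^ k * w m) \<le> B * w (m + k)" using Suc B by (intro mult_left_mono) auto
    also have "\<dots> \<le> w (m + Suc k)" using N[of "m + Suc k"] that by simp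
    finally show ?case by (simp add: mult_ac)
  qed simp
  define V where "V = (\<lambda>n. \<Sum>m=1..n. w m)"
  \<comment> \<open>The quotient settles the base case at N; C >= 2 is used in the step, where C w_n
    <= (C/2) w_{n+1} and w_{n+1} <= (C/2) w_{n+1}.\<close>
  define C where "C = max 2 (\<bar>V N\<bar> / w N)"
  have V: "\<bar>V n\<bar> \<le> C * w n" if "n \<ge> N" for n
    using that
  proof (induction n rule: dec_induct)
    case base
    have "\<bar>V N\<bar> = \<bar>V N\<bar> / w N * w N" using N[of N] by simp
    also have "\<dots> \<le> C * w N" using N[of N] by (intro mult_right_mono) (auto simp: C_def)
    finally show ?case .
  next
    case (step n)
    have wn: "w n > 0" "2 * w n \<le> w (Suc n)" "w (Suc n) > 0"
      using N[of n] N[of "Suc n"] step.hyps mult_right_mono[OF B, of "w n"]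
      by (auto intro: order.trans[of _ "B * w n"])
    have "\<bar>V (Suc n)\<bar> \<le> \<bar>V n\<bar> + w (Suc n)" using wn by (simp add: V_def)
    also have "\<dots> \<le> C * w n + w (Suc n)" using step by simp
    also have "\<dots> \<le> C * (w (Suc n) / 2) + C / 2 * w (Suc n)"
      using wn by (intro add_mono mult_left_mono) (auto simp: C_def)
    finally show ?case by simp
  qed
  have "eventually (\<lambda>n. norm (L ^ n * V (n div 2)) \<le> (C * B ^ R) * norm (w (n - R))) sequentially"
    using eventually_ge_at_top[of "2 * N + 2 * R"]
  proof eventually_elim
    case (elim n)
    define m where "m = n div 2"
    define k where "k = n - R - m"
    \<comment> \<open>There are k steps from m to n - R, and k + R >= n/2; the R missing steps cost
      only the constant \<open>B ^ R\<close>.\<close>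
    have m: "m \<ge> N" "n - R = m + k" "n \<le> 2 * (k + R)" using elim by (auto simp: m_def k_def)
    have "\<bar>L\<bar> ^ n \<le> (\<bar>L\<bar> + 1) ^ n" by (intro power_mono) auto
    also have "\<dots> \<le> (\<bar>L\<bar> + 1) ^ (2 * (k + R))" using m by (intro power_increasing) auto
    also have "\<dots> = ((\<bar>L\<bar> + 1)\<^sup>2) ^ (k + R)" by (simp only: power_mult)
    also have "\<dots> \<le> B ^ (k + R)" using sq by (intro power_mono) (auto simp: B_def)
    finally have L: "\<bar>L\<bar> ^ n \<le> B ^ k * B ^ R" by (simp add: power_add)
    have "\<bar>L\<bar> ^ n * \<bar>V m\<bar> \<le> (B ^ k * B ^ R) * (C * w m)"
      using L V[OF m(1)] B by (intro mult_mono) auto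
    also have "\<dots> = C * B ^ R * (B ^ k * w m)" by simp
    also have "\<dots> \<le> C * B ^ R * w (n - R)"
      unfolding m(2) using B by (intro mult_left_mono grow m) (auto simp: C_def)
    also have "\<dots> \<le> C * B ^ R * norm (w (n - R))"
      using B by (intro mult_left_mono) (auto simp: C_def)
    finally show ?case by (simp add: abs_mult power_abs m_def)
  qed
  thus ?thesis unfolding V_def by (rule bigoI)
qed

text \<open>Terms with s + j < R collect into the coefficients of the product of q and p. The
  remaining pairs, indexed by \<open>?D\<close>, have s + j >= R, and each is a shift of v by at
  least R.\<close>

lemma truncated_conv_bigo:
  assumes v: "v \<in> O(w)"
  shows "(\<lambda>n. (\<Sum>s<R. q s * (\<Sum>j<R. p j * v (n - s - j))) -
              (\<Sum>u<R. (\<Sum>s\<le>u. q s * p (u - s)) * v (n - u))) \<in> O(\<lambda>n. w (n - R))"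
proof -
  let ?D = "Sigma {..<R} (\<lambda>s. {R-s..<R})"
  have split: "(\<Sum>s<R. q s * (\<Sum>j<R. p j * v (n - s - j))) -
       (\<Sum>u<R. (\<Sum>s\<le>u. q s * p (u - s)) * v (n - u)) =
       (\<Sum>(s,j)\<in>?D. q s * p j * v (n - (s + j)))" for n
  proof -
    let ?g = "\<lambda>s j. q s * p j * v (n - (s + j))"
    have "(\<Sum>s<R. q s * (\<Sum>j<R. p j * v (n - s - j))) = (\<Sum>s<R. \<Sum>j<R. ?g s j)"
      by (simp add: sum_distrib_left mult.assoc)
    also have "\<dots> = (\<Sum>s<R. (\<Sum>j<R-s. ?g s j) + (\<Sum>j=R-s..<R. ?g s j))"
    proof (intro sum.cong refl)
      fix s
      have "(\<Sum>j\<in>{..<R-s} \<union> {R-s..<R}. ?g s j) = (\<Sum>j<R-s. ?g s j) + (\<Sum>j=R-s..<R. ?g s j)"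
        by (rule sum.union_disjoint) auto
      moreover have "{..<R-s} \<union> {R-s..<R} = {..<R}" by auto
      ultimately show "(\<Sum>j<R. ?g s j) = (\<Sum>j<R-s. ?g s j) + (\<Sum>j=R-s..<R. ?g s j)"
        by simp
    qed
    also have "\<dots> = (\<Sum>s<R. \<Sum>j<R-s. ?g s j) + (\<Sum>(s,j)\<in>?D. ?g s j)"
      by (simp add: sum.distrib sum.Sigma)
    also have "(\<Sum>s<R. \<Sum>j<R-s. ?g s j) = (\<Sum>(s,j)\<in>Sigma {..<R} (\<lambda>s. {..<R-s}). ?g s j)"
      by (simp add: sum.Sigma)
    also have "Sigma {..<R} (\<lambda>s. {..<R-s}) = {(i,j). i + j < R}" by auto
    also have "(\<Sum>(s,j)\<in>{(i,j). i + j < R}. ?g s j) = (\<Sum>u<R. \<Sum>s\<le>u. ?g s (u - s))"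
      by (rule sum.triangle_reindex)
    also have "\<dots> = (\<Sum>u<R. (\<Sum>s\<le>u. q s * p (u - s)) * v (n - u))"
      by (simp add: sum_distrib_right)
    finally show ?thesis by simp
  qed
  have "(\<lambda>n. \<Sum>(s,j)\<in>?D. q s * p j * v (n - (s + j))) \<in> O(\<lambda>n. w (n - R))"
    unfolding case_prod_beta
    by (intro big_sum_in_bigo) (auto intro!: landau_o.big.mult_in_1 bigo_shift0[OF v])
  thus ?thesis by (simp only: split)
qed

text \<open>Substitute u = (truncated convolution of p and v) + e: since q inverts p, the double sum
  collapses to v up to O(w (n - R)), and the shifts of e are no larger than e's own bound.\<close>

lemma truncated_inverse:
  assumes v: "v \<in> O(w)"
    and inv: "\<And>n. (\<Sum>s\<le>n. q s * p (n - s)) = (if n = 0 then 1 else 0 :: real)"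
    and R: "R \<ge> 1"
    and uv: "(\<lambda>n. u n - (\<Sum>s<R. p s * v (n - s))) \<in> O(\<lambda>n. w (n - R))"
  shows "(\<lambda>n. v n - (\<Sum>s<R. q s * u (n - s))) \<in> O(\<lambda>n. w (n - R))"
proof -
  define e where "e = (\<lambda>n. u n - (\<Sum>s<R. p s * v (n - s)))"
  let ?d = "\<lambda>n. (\<Sum>s<R. q s * (\<Sum>j<R. p j * v (n - s - j))) -
              (\<Sum>u<R. (\<Sum>s\<le>u. q s * p (u - s)) * v (n - u))"
  \<comment> \<open>Only u = 0 survives, and it is in range because R >= 1.\<close>
  have v_eq: "(\<Sum>u<R. (\<Sum>s\<le>u. q s * p (u - s)) * v (n - u)) = v n" for n
    using R by (simp add: inv if_distrib[of "\<lambda>x. x * _"] sum.delta cong: if_cong)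
  have "v n - (\<Sum>s<R. q s * u (n - s)) = - ?d n - (\<Sum>s<R. q s * e (n - s))" for n
    unfolding v_eq by (simp add: e_def algebra_simps sum_subtractf sum_distrib_left)
  moreover have "(\<lambda>n. - ?d n - (\<Sum>s<R. q s * e (n - s))) \<in> O(\<lambda>n. w (n - R))"
  proof (intro sum_in_bigo big_sum_in_bigo)
    show "(\<lambda>n. - ?d n) \<in> O(\<lambda>n. w (n - R))"
      using truncated_conv_bigo[OF v, where R = R and q = q and p = p] by (simp only: landau_o.big.uminus_in_iff)
    show "(\<lambda>n. q s * e (n - s)) \<in> O(\<lambda>n. w (n - R))" for s
      using bigo_shift[OF uv[folded e_def], of R s] by (cases "q s = 0") auto
  qed
  ultimately show ?thesis by simp
qed

end

section \<open>Middle convolution sums and the index weight\<close>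

lemma of_nat_mult_bigo_cancel:
  assumes "(\<lambda>n. real n * f n) \<in> O(\<lambda>n. real n * g n)"
  shows "f \<in> O(g)"
proof -
  obtain c where "eventually (\<lambda>n. norm (real n * f n) \<le> c * norm (real n * g n)) sequentially"
    using assms by (elim landau_o.bigE)
  hence "eventually (\<lambda>n. norm (f n) \<le> c * norm (g n)) sequentially"
    using eventually_gt_at_top[of 0]
  proof eventually_elim
    case (elim n)
    hence "real n * \<bar>f n\<bar> \<le> real n * (c * \<bar>g n\<bar>)" by (simp add: abs_mult mult_ac)
    with elim(2) show ?case by simp
  qed
  thus ?thesis by (rule bigoI)
qed

lemma sum_middle_split:
  fixes g :: "nat \<Rightarrow> real"
  assumes "R \<le> N" "2 * N \<le> n"
  shows "(\<Sum>s=R..n-R. g s) = (\<Sum>s=R..<N. g s) + (\<Sum>s=N..n-N. g s) + (\<Sum>s=R..<N. g (n - s))"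
proof -
  have "{R..n-R} = {R..<N} \<union> ({N..n-N} \<union> {n-N<..n-R})" using assms by auto
  hence "(\<Sum>s=R..n-R. g s) = (\<Sum>s=R..<N. g s) + ((\<Sum>s=N..n-N. g s) + (\<Sum>s\<in>{n-N<..n-R}. g s))"
  proof (simp only:, subst sum.union_disjoint)
    have "(\<Sum>s\<in>{N..n-N} \<union> {n-N<..n-R}. g s) = (\<Sum>s=N..n-N. g s) + (\<Sum>s\<in>{n-N<..n-R}. g s)"
      by (rule sum.union_disjoint) auto
    thus "sum g {R..<N} + sum g ({N..n-N} \<union> {n-N<..n-R}) =
      sum g {R..<N} + (sum g {N..n-N} + sum g {n-N<..n-R})" by simp
  qed (use assms in auto)
  also have "(\<Sum>s\<in>{n-N<..n-R}. g s) = (\<Sum>s=R..<N. g (n - s))"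
    using assms by (intro sum.reindex_bij_witness[of _ "\<lambda>s. n - s" "\<lambda>s. n - s"]) auto
  finally show ?thesis by simp
qed

text \<open>Moving the cutoff from R to N removes a fixed number of terms at each end, each O(G).
  This allows N to be so large that eventual bounds hold for every remaining term.\<close>

lemma middle_sum_bigo_iff:
  fixes g :: "nat \<Rightarrow> nat \<Rightarrow> real"
  assumes N: "R \<le> N"
    and low: "\<And>s. R \<le> s \<Longrightarrow> (\<lambda>n. g n s) \<in> O(G)"
    and high: "\<And>s. R \<le> s \<Longrightarrow> (\<lambda>n. g n (n - s)) \<in> O(G)"
  shows "(\<lambda>n. \<Sum>s=R..n-R. g n s) \<in> O(G) \<longleftrightarrow> (\<lambda>n. \<Sum>s=N..n-N. g n s) \<in> O(G)"
proof -
  let ?E = "\<lambda>n. (\<Sum>s=R..<N. g n s) + (\<Sum>s=R..<N. g n (n - s))"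
  have E: "?E \<in> O(G)"
    using low high by (intro sum_in_bigo big_sum_in_bigo) auto
  have ev: "eventually (\<lambda>n. (\<Sum>s=R..n-R. g n s) = (\<Sum>s=N..n-N. g n s) + ?E n) sequentially"
    using eventually_ge_at_top[of "2 * N"]
    by eventually_elim (subst sum_middle_split[OF N], auto)
  have "(\<lambda>n. \<Sum>s=R..n-R. g n s) \<in> O(G) \<longleftrightarrow> (\<lambda>n. (\<Sum>s=N..n-N. g n s) + ?E n) \<in> O(G)"
    by (rule landau_o.big.in_cong[OF ev])
  also have "\<dots> \<longleftrightarrow> (\<lambda>n. \<Sum>s=N..n-N. g n s) \<in> O(G)"
    using sum_in_bigo(1)[OF _ E, of "\<lambda>n. \<Sum>s=N..n-N. g n s"]
      sum_in_bigo(2)[OF _ E, of "\<lambda>n. (\<Sum>s=N..n-N. g n s) + ?E n"] by auto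
  finally show ?thesis .
qed

text \<open>Add the sum to its reflection under s -> n - s; the two weights add up to n.\<close>

lemma sum_index_weight_symmetric:
  fixes w :: "nat \<Rightarrow> real"
  assumes "N \<le> n"
  shows "2 * (\<Sum>s=N..n-N. real s * (w s * w (n - s))) = real n * (\<Sum>s=N..n-N. w s * w (n - s))"
proof -
  have "(\<Sum>s=N..n-N. real s * (w s * w (n - s))) = (\<Sum>s=N..n-N. real (n - s) * (w s * w (n - s)))"
    using assms by (intro sum.reindex_bij_witness[of _ "\<lambda>s. n - s" "\<lambda>s. n - s"]) auto
  hence "2 * (\<Sum>s=N..n-N. real s * (w s * w (n - s))) =
    (\<Sum>s=N..n-N. real s * (w s * w (n - s)) + real (n - s) * (w s * w (n - s)))"
    by (simp add: sum.distrib)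
  also have "\<dots> = (\<Sum>s=N..n-N. real n * (w s * w (n - s)))"
    by (intro sum.cong) (auto simp: of_nat_diff algebra_simps)
  finally show ?thesis by (simp add: sum_distrib_left)
qed

context fast_growing
begin

lemma conv_middle_iff:
  assumes "R \<le> N"
  shows "(\<lambda>n. \<Sum>s=R..n-R. w s * w (n - s)) \<in> O(\<lambda>n. w (n - R)) \<longleftrightarrow>
         (\<lambda>n. \<Sum>s=N..n-N. w s * w (n - s)) \<in> O(\<lambda>n. w (n - R))"
proof (rule middle_sum_bigo_iff[OF assms])
  fix s assume s: "R \<le> s"
  have *: "(\<lambda>n. w (n - s)) \<in> O(\<lambda>n. w (n - R))" using s by (rule shift_bigo)
  show "(\<lambda>n. w s * w (n - s)) \<in> O(\<lambda>n. w (n - R))"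
    using * by (cases "w s = 0") auto
  have ev: "eventually (\<lambda>n. w (n - s) * w (n - (n - s)) = w s * w (n - s)) sequentially"
    using eventually_ge_at_top[of s] by eventually_elim auto
  show "(\<lambda>n. w (n - s) * w (n - (n - s))) \<in> O(\<lambda>n. w (n - R))"
    unfolding landau_o.big.in_cong[OF ev] using * by (cases "w s = 0") auto
qed

text \<open>At the lower end the weight s is constant, at the upper end it is n - s <= n; both fit
  into n w (n - R).\<close>

lemma weighted_conv_middle_iff:
  assumes "R \<le> N" and h: "h \<in> O(w)" and T: "T \<in> O(w)"
  shows "(\<lambda>n. \<Sum>s=R..n-R. real s * h s * T (n - s)) \<in> O(\<lambda>n. real n * w (n - R)) \<longleftrightarrow>
         (\<lambda>n. \<Sum>s=N..n-N. real s * h s * T (n - s)) \<in> O(\<lambda>n. real n * w (n - R))"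
proof (rule middle_sum_bigo_iff[OF assms(1)])
  fix s assume s: "R \<le> s"
  have 1: "(\<lambda>_. c) \<in> O(\<lambda>n. real n)" for c :: real
    by (rule bigoI[of _ "\<bar>c\<bar>"], use eventually_ge_at_top[of 1] in eventually_elim)
       (auto simp: mult_le_cancel_left1)
  show "(\<lambda>n. real s * h s * T (n - s)) \<in> O(\<lambda>n. real n * w (n - R))"
    using s by (intro landau_o.big.mult 1 bigo_shift0[OF T])
  have ev: "eventually (\<lambda>n. real (n - s) * h (n - s) * T (n - (n - s)) = (T s * real (n - s)) * h (n - s)) sequentially"
    using eventually_ge_at_top[of s] by eventually_elim auto
  have "(\<lambda>n. T s * real (n - s)) \<in> O(\<lambda>n. real n)"
    by (intro bigoI[of _ "\<bar>T s\<bar>"] always_eventually) (auto simp: abs_mult intro!: mult_left_mono)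
  thus "(\<lambda>n. real (n - s) * h (n - s) * T (n - (n - s))) \<in> O(\<lambda>n. real n * w (n - R))"
    unfolding landau_o.big.in_cong[OF ev] using s by (intro landau_o.big.mult bigo_shift0[OF h])
qed

text \<open>Raise the cutoff until h and T are bounded pointwise by multiples of w, compare term by
  term, and symmetrize the weight.\<close>

lemma weighted_conv_bigo:
  assumes h: "h \<in> O(w)" and T: "T \<in> O(w)"
    and S: "(\<lambda>n. \<Sum>s=R..n-R. w s * w (n - s)) \<in> O(\<lambda>n. w (n - R))"
  shows "(\<lambda>n. \<Sum>s=R..n-R. real s * h s * T (n - s)) \<in> O(\<lambda>n. real n * w (n - R))"
proof -
  obtain c d where c: "c > 0" "eventually (\<lambda>n. norm (h n) \<le> c * norm (w n)) sequentially"
    and d: "d > 0" "eventually (\<lambda>n. norm (T n) \<le> d * norm (w n)) sequentially"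
    using h T by (elim landau_o.bigE)
  obtain N0 where N0: "\<And>n. n \<ge> N0 \<Longrightarrow> w n > 0 \<and> \<bar>h n\<bar> \<le> c * \<bar>w n\<bar> \<and> \<bar>T n\<bar> \<le> d * \<bar>w n\<bar>"
    using eventually_conj[OF eventually_pos eventually_conj[OF c(2) d(2)]]
    by (auto simp: eventually_at_top_linorder)
  define N where "N = max N0 R"
  have N: "w n > 0" "\<bar>h n\<bar> \<le> c * w n" "\<bar>T n\<bar> \<le> d * w n" if "n \<ge> N" for n
    using N0[of n] that by (auto simp: N_def)
  have "R \<le> N" by (simp add: N_def)
  have "(\<lambda>n. \<Sum>s=N..n-N. real s * h s * T (n - s)) \<in> O(\<lambda>n. real n * (\<Sum>s=N..n-N. w s * w (n - s)))"
  proof (rule bigoI)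
    show "eventually (\<lambda>n. norm (\<Sum>s=N..n-N. real s * h s * T (n - s)) \<le>
      (c * d / 2) * norm (real n * (\<Sum>s=N..n-N. w s * w (n - s)))) sequentially"
      using eventually_ge_at_top[of N]
    proof eventually_elim
      case (elim n)
      have "\<bar>\<Sum>s=N..n-N. real s * h s * T (n - s)\<bar> \<le> (\<Sum>s=N..n-N. c * d * (real s * (w s * w (n - s))))"
      proof (intro order.trans[OF sum_abs] sum_mono)
        fix s assume s: "s \<in> {N..n-N}"
        have "N \<le> n - s" using s elim by auto
        hence "\<bar>h s\<bar> * \<bar>T (n - s)\<bar> \<le> (c * w s) * (d * w (n - s))"
          using s N[of s] N[of "n - s"] c(1) by (intro mult_mono) auto
        hence "real s * (\<bar>h s\<bar> * \<bar>T (n - s)\<bar>) \<le> real s * ((c * w s) * (d * w (n - s)))"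
          by (rule mult_left_mono) simp
        thus "\<bar>real s * h s * T (n - s)\<bar> \<le> c * d * (real s * (w s * w (n - s)))"
          by (simp add: abs_mult mult_ac)
      qed
      also have "\<dots> = (c * d / 2) * (2 * (\<Sum>s=N..n-N. real s * (w s * w (n - s))))"
        by (simp add: sum_distrib_left mult.assoc)
      also have "\<dots> = (c * d / 2) * (real n * (\<Sum>s=N..n-N. w s * w (n - s)))"
        by (simp only: sum_index_weight_symmetric[OF elim])
      also have "\<dots> \<le> (c * d / 2) * \<bar>real n * (\<Sum>s=N..n-N. w s * w (n - s))\<bar>"
        using c d by (intro mult_left_mono) auto
      finally show ?case by simp
    qed
  qed
  also have "(\<lambda>n. real n * (\<Sum>s=N..n-N. w s * w (n - s))) \<in> O(\<lambda>n. real n * w (n - R))"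
    using S unfolding conv_middle_iff[OF \<open>R \<le> N\<close>] by (rule landau_o.big.mult[OF landau_o.big_refl])
  finally show ?thesis
    unfolding weighted_conv_middle_iff[OF \<open>R \<le> N\<close> h T] .
qed

text \<open>The converse comparison bounds w from above by h and by T. It needs their signs, since
  cancellation in the weighted sum would destroy the bound.\<close>

lemma conv_bigo_of_weighted:
  assumes h: "h \<in> O(w)" "w \<in> O(h)" "eventually (\<lambda>n. h n \<ge> 0) sequentially"
    and T: "T \<in> O(w)" "w \<in> O(T)" "eventually (\<lambda>n. T n \<ge> 0) sequentially"
    and X: "(\<lambda>n. \<Sum>s=R..n-R. real s * h s * T (n - s)) \<in> O(\<lambda>n. real n * w (n - R))"
  shows "(\<lambda>n. \<Sum>s=R..n-R. w s * w (n - s)) \<in> O(\<lambda>n. w (n - R))"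
proof -
  obtain c d where c: "c > 0" "eventually (\<lambda>n. norm (w n) \<le> c * norm (h n)) sequentially"
    and d: "d > 0" "eventually (\<lambda>n. norm (w n) \<le> d * norm (T n)) sequentially"
    using h(2) T(2) by (elim landau_o.bigE)
  have "eventually (\<lambda>n. w n > 0 \<and> w n \<le> c * h n \<and> w n \<le> d * T n) sequentially"
    using eventually_pos c(2) d(2) h(3) T(3) by eventually_elim auto
  then obtain N0 where N0: "\<And>n. n \<ge> N0 \<Longrightarrow> w n > 0 \<and> w n \<le> c * h n \<and> w n \<le> d * T n"
    by (auto simp: eventually_at_top_linorder)
  define N where "N = max N0 R"
  have N: "w n > 0" "w n \<le> c * h n" "w n \<le> d * T n" if "n \<ge> N" for n
    using N0[of n] that by (auto simp: N_def)
  have "R \<le> N" by (simp add: N_def)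
  have "(\<lambda>n. real n * (\<Sum>s=N..n-N. w s * w (n - s))) \<in> O(\<lambda>n. \<Sum>s=N..n-N. real s * h s * T (n - s))"
  proof (rule bigoI)
    show "eventually (\<lambda>n. norm (real n * (\<Sum>s=N..n-N. w s * w (n - s))) \<le>
      (2 * c * d) * norm (\<Sum>s=N..n-N. real s * h s * T (n - s))) sequentially"
      using eventually_ge_at_top[of N]
    proof eventually_elim
      case (elim n)
      have pos: "w s * w (n - s) \<ge> 0" if "s \<in> {N..n-N}" for s
      proof -
        have "s \<ge> N" "n - s \<ge> N" using that elim by auto
        thus ?thesis using N(1)[of s] N(1)[of "n - s"] by simp
      qed
      have "\<bar>real n * (\<Sum>s=N..n-N. w s * w (n - s))\<bar> = real n * (\<Sum>s=N..n-N. w s * w (n - s))"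
        using pos by (intro abs_of_nonneg mult_nonneg_nonneg[OF of_nat_0_le_iff] sum_nonneg) blast
      also have "\<dots> = 2 * (\<Sum>s=N..n-N. real s * (w s * w (n - s)))"
        by (simp only: sum_index_weight_symmetric[OF elim])
      also have "(\<Sum>s=N..n-N. real s * (w s * w (n - s))) \<le> (\<Sum>s=N..n-N. c * d * (real s * h s * T (n - s)))"
      proof (rule sum_mono)
        fix s assume s: "s \<in> {N..n-N}"
        have "N \<le> n - s" using s elim by auto
        hence "w s * w (n - s) \<le> (c * h s) * (d * T (n - s))"
          using s N[of s] N[of "n - s"] by (intro mult_mono) auto
        hence "real s * (w s * w (n - s)) \<le> real s * ((c * h s) * (d * T (n - s)))"
          by (rule mult_left_mono) simp
        thus "real s * (w s * w (n - s)) \<le> c * d * (real s * h s * T (n - s))"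
          by (simp add: mult_ac)
      qed
      also have "2 * (\<Sum>s=N..n-N. c * d * (real s * h s * T (n - s))) =
          (2 * c * d) * (\<Sum>s=N..n-N. real s * h s * T (n - s))"
        by (simp add: sum_distrib_left mult_ac)
      also have "\<dots> \<le> (2 * c * d) * \<bar>\<Sum>s=N..n-N. real s * h s * T (n - s)\<bar>"
        using c d by (intro mult_left_mono) auto
      finally show ?case by simp
    qed
  qed
  also have "(\<lambda>n. \<Sum>s=N..n-N. real s * h s * T (n - s)) \<in> O(\<lambda>n. real n * w (n - R))"
    using X unfolding weighted_conv_middle_iff[OF \<open>R \<le> N\<close> h(1) T(1)] .
  finally show ?thesis
    unfolding conv_middle_iff[OF \<open>R \<le> N\<close>] by (rule of_nat_mult_bigo_cancel)
qed

end

section \<open>The truncated remainder and the recurrence\<close>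

lemma sum_lessThan_eq_first_plus:
  fixes g :: "nat \<Rightarrow> real"
  assumes "R \<ge> 1"
  shows "(\<Sum>s<R. g s) = g 0 + (\<Sum>s=1..<R. g s)"
  using assms by (simp add: lessThan_atLeast0 sum.atLeast_Suc_lessThan)

context fast_growing
begin

text \<open>All terms with s >= 1 are shifts by at least 1. Used with \<open>p = beta T\<close> to
  compare h with T, and with \<open>p = T\<close> to compare T with h.\<close>

lemma expansion_leading_term:
  assumes v: "v \<in> O(w)" and R: "R \<ge> 1" and p: "p 0 = 1"
    and uv: "(\<lambda>n. u n - (\<Sum>s<R. p s * v (n - s))) \<in> O(\<lambda>n. w (n - R))"
  shows "(\<lambda>n. u n - v n) \<in> O(\<lambda>n. w (n - 1))"
proof -
  have "(\<lambda>n. (u n - (\<Sum>s<R. p s * v (n - s))) + (\<Sum>s=1..<R. p s * v (n - s))) \<in> O(\<lambda>n. w (n - 1))"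
    using bigo_weaken[OF uv R]
    by (intro sum_in_bigo(1) big_sum_in_bigo) (auto intro!: landau_o.big.mult_in_1 bigo_shift0[OF v])
  moreover have "(u n - (\<Sum>s<R. p s * v (n - s))) + (\<Sum>s=1..<R. p s * v (n - s)) = u n - v n" for n
    using sum_lessThan_eq_first_plus[OF R, of "\<lambda>s. p s * v (n - s)"] p by simp
  ultimately show ?thesis by (simp only:)
qed

text \<open>The error is o(w), so eventually f lies between (k/2) w and 2 k w.\<close>

lemma comparable_of_leading_term:
  assumes "(\<lambda>n. f n - k * w n) \<in> O(\<lambda>n. w (n - 1))" "k > 0"
  shows "f \<in> O(w)" "w \<in> O(f)" "eventually (\<lambda>n. f n > 0) sequentially"
proof -
  have "(\<lambda>n. f n - k * w n) \<in> o(w)"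
    by (rule landau_o.big_small_trans[OF assms(1) ratio])
  hence "eventually (\<lambda>n. norm (f n - k * w n) \<le> (k / 2) * norm (w n)) sequentially"
    by (rule landau_o.smallD) (use assms in simp)
  hence ev: "eventually (\<lambda>n. w n > 0 \<and> k / 2 * w n \<le> f n \<and> f n \<le> 2 * k * w n) sequentially"
    using eventually_pos
  proof eventually_elim
    case (elim n)
    have "0 < k * w n" using elim assms(2) by simp
    moreover have "\<bar>f n - k * w n\<bar> \<le> k * w n / 2" using elim by simp
    note abs_le_D1[OF this] abs_le_D2[OF this]
    ultimately show ?case using elim by simp
  qed
  thus "eventually (\<lambda>n. f n > 0) sequentially"
  proof eventually_elim
    case (elim n)
    have "0 < k / 2 * w n" using elim assms(2) by simp
    also have "\<dots> \<le> f n" using elim by simp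
    finally show ?case .
  qed
  have "eventually (\<lambda>n. norm (f n) \<le> 2 * k * norm (w n)) sequentially"
    using ev
  proof eventually_elim
    case (elim n)
    have "0 < k / 2 * w n" using elim assms(2) by simp
    thus ?case using elim by simp
  qed
  thus "f \<in> O(w)" by (rule bigoI)
  have "eventually (\<lambda>n. norm (w n) \<le> 2 / k * norm (f n)) sequentially"
    using ev
  proof eventually_elim
    case (elim n)
    have "0 < k / 2 * w n" using elim assms(2) by simp
    thus ?case using elim assms(2) by (simp add: field_simps)
  qed
  thus "w \<in> O(f)" by (rule bigoI)
qed

text \<open>Carries the ratio condition from T to t and back once the two are known to be
  comparable.\<close>

lemma fast_growing_transfer:
  assumes "f \<in> O(w)" "w \<in> O(f)" "eventually (\<lambda>n. f n > 0) sequentially"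
  shows "fast_growing f"
proof
  have "(\<lambda>n. f (n - 1)) \<in> O(\<lambda>n. w (n - 1))"
    using bigo_shift0[OF assms(1), of 1 1] by simp
  also note ratio
  also note assms(2)
  finally show "(\<lambda>n. f (n - 1)) \<in> o(f)" .
qed fact

context
  fixes T h :: "nat \<Rightarrow> real"
  assumes rec: "\<And>n. real n * T n = (\<Sum>s=1..n. real s * h s * T (n - s))"
begin

text \<open>Cut the recurrence into s < R, the middle, and s > n - R. Reflected, the last block has
  weight n - s: its n-part moves to the left side and its s-part stays as a correction.\<close>

lemma remainder_identity:
  assumes "2 * R \<le> n"
  shows "real n * (T n - (\<Sum>s<R. T s * h (n - s))) =
    (\<Sum>s=R..n-R. real s * h s * T (n - s)) +
    ((\<Sum>s<R. real s * h s * T (n - s)) - (\<Sum>s<R. real s * T s * h (n - s)))"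
proof -
  let ?g = "\<lambda>s. real s * h s * T (n - s)"
  have "real n * T n = (\<Sum>s=0..n-0. ?g s)"
    using rec[of n] by (simp add: sum.atLeast_Suc_atMost)
  also have "\<dots> = (\<Sum>s=0..<R. ?g s) + (\<Sum>s=R..n-R. ?g s) + (\<Sum>s=0..<R. ?g (n - s))"
    using assms by (intro sum_middle_split) auto
  also have "(\<Sum>s=0..<R. ?g (n - s)) = (\<Sum>s=0..<R. real n * (T s * h (n - s)) - real s * T s * h (n - s))"
    using assms by (intro sum.cong) (auto simp: of_nat_diff algebra_simps)
  finally show ?thesis
    by (simp add: sum_subtractf sum_distrib_left lessThan_atLeast0 algebra_simps)
qed

text \<open>The terms of \<open>n e\<^sub>n\<close> with an index below \<open>R\<close> cancel up to \<open>O(w (n - R))\<close> when each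
  \<open>T (n - s)\<close> is replaced by its truncated expansion plus \<open>e (n - s)\<close>; since the coefficient of
  \<open>e n\<close> on the right is 0, a bound for the middle sum then improves the bound on \<open>e\<close> by one shift
  at a time.\<close>

lemma remainder_bigo_iff:
  assumes h: "h \<in> O(w)" and T: "T \<in> O(w)"
  shows "(\<lambda>n. \<Sum>s=R..n-R. real s * h s * T (n - s)) \<in> O(\<lambda>n. real n * w (n - R)) \<longleftrightarrow>
         (\<lambda>n. T n - (\<Sum>s<R. T s * h (n - s))) \<in> O(\<lambda>n. w (n - R))"
proof -
  define e where "e = (\<lambda>n. T n - (\<Sum>s<R. T s * h (n - s)))"
  define X where "X = (\<lambda>n. \<Sum>s=R..n-R. real s * h s * T (n - s))"
  define E where "E = (\<lambda>n. \<Sum>s<R. real s * h s * e (n - s))"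
  define r where "r = (\<lambda>n. (\<Sum>s<R. (real s * h s) * (\<Sum>j<R. T j * h (n - s - j))) -
              (\<Sum>u<R. (\<Sum>s\<le>u. (real s * h s) * T (u - s)) * h (n - u)))"
  have r: "r \<in> O(\<lambda>n. w (n - R))" unfolding r_def by (rule truncated_conv_bigo[OF h])
  \<comment> \<open>By the recurrence, the convolution of s h_s with T is u T_u, so the second sum
    in \<open>r\<close> is the correction sum of \<open>remainder_identity\<close>.\<close>
  have coeff: "(\<Sum>s\<le>u. real s * h s * T (u - s)) = real u * T u" for u
    using rec[of u] by (simp add: atMost_atLeast0 sum.atLeast_Suc_atMost)
  have r_eq: "r n = ((\<Sum>s<R. real s * h s * T (n - s)) - (\<Sum>s<R. real s * T s * h (n - s))) - E n" for n
    unfolding r_def coeff by (simp add: E_def e_def algebra_simps sum_subtractf)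
  have ev: "eventually (\<lambda>n. real n * e n = X n + (r n + E n)) sequentially"
    using eventually_ge_at_top[of "2 * R"]
    by eventually_elim (simp add: e_def X_def r_eq remainder_identity)
  have le_n: "g \<in> O(\<lambda>n. real n * w (n - k))" if "g \<in> O(\<lambda>n. w (n - k))" for g k
  proof -
    have "(\<lambda>n. 1 * g n) \<in> O(\<lambda>n. real n * w (n - k))"
      by (rule landau_o.big.mult[OF _ that], rule bigoI[of _ 1], rule eventually_mono[OF eventually_ge_at_top[of 1]]) auto
    thus ?thesis by simp
  qed
  have E_bound: "E \<in> O(\<lambda>n. w (n - i))" if "e \<in> O(\<lambda>n. w (n - k))" "i \<le> Suc k" for i k
    unfolding E_def
  proof (rule big_sum_in_bigo)
    fix s
    show "(\<lambda>n. real s * h s * e (n - s)) \<in> O(\<lambda>n. w (n - i))"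
    proof (cases "s = 0")
      case False
      hence "(\<lambda>n. e (n - s)) \<in> O(\<lambda>n. w (n - i))"
        using that(2) by (intro bigo_shift[OF that(1)]) simp
      thus ?thesis by (cases "real s * h s = 0") auto
    qed simp
  qed
  have "X \<in> O(\<lambda>n. real n * w (n - R)) \<longleftrightarrow> e \<in> O(\<lambda>n. w (n - R))"
  proof
    assume X: "X \<in> O(\<lambda>n. real n * w (n - R))"
    have "e \<in> O(\<lambda>n. w (n - k))" if "k \<le> R" for k
      using that
    proof (induction k)
      case 0
      show ?case unfolding e_def
        using T bigo_shift0[OF h, of 0]
        by (intro sum_in_bigo(2) big_sum_in_bigo) (auto intro!: landau_o.big.mult_in_1)
    next
      case (Suc k)
      have "(\<lambda>n. X n + (r n + E n)) \<in> O(\<lambda>n. real n * w (n - Suc k))"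
      proof (intro sum_in_bigo(1))
        show "X \<in> O(\<lambda>n. real n * w (n - Suc k))"
          by (rule landau_o.big_trans[OF X]) (intro landau_o.big.mult landau_o.big_refl shift_bigo Suc.prems)
        show "r \<in> O(\<lambda>n. real n * w (n - Suc k))"
          by (rule le_n, rule bigo_weaken[OF r Suc.prems])
        show "E \<in> O(\<lambda>n. real n * w (n - Suc k))"
          using Suc by (intro le_n E_bound[of k]) auto
      qed
      hence "(\<lambda>n. real n * e n) \<in> O(\<lambda>n. real n * w (n - Suc k))"
        by (simp only: landau_o.big.in_cong[OF ev])
      thus ?case by (rule of_nat_mult_bigo_cancel)
    qed
    thus "e \<in> O(\<lambda>n. w (n - R))" by simp
  next
    assume e: "e \<in> O(\<lambda>n. w (n - R))"
    have ev': "eventually (\<lambda>n. X n = real n * e n - (r n + E n)) sequentially"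
      using ev by eventually_elim simp
    have "(\<lambda>n. real n * e n - (r n + E n)) \<in> O(\<lambda>n. real n * w (n - R))"
      using e by (intro sum_in_bigo landau_o.big.mult landau_o.big_refl le_n r E_bound[of R]) auto
    thus "X \<in> O(\<lambda>n. real n * w (n - R))"
      by (simp only: landau_o.big.in_cong[OF ev'])
  qed
  thus ?thesis unfolding X_def e_def .
qed

end

end

section \<open>An a priori bound for T from the recurrence\<close>

lemma bigo_pos_uniform_bound:
  fixes f g :: "nat \<Rightarrow> real"
  assumes "f \<in> O(g)" "\<And>n. g n > 0"
  obtains C where "C > 0" "\<And>n. \<bar>f n\<bar> \<le> C * g n"
proof -
  obtain c where c: "c > 0" "eventually (\<lambda>n. norm (f n) \<le> c * norm (g n)) sequentially"
    using assms(1) by (elim landau_o.bigE)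
  then obtain N where N: "\<And>n. n \<ge> N \<Longrightarrow> \<bar>f n\<bar> \<le> c * \<bar>g n\<bar>"
    by (auto simp: eventually_at_top_linorder)
  define S where "S = (\<Sum>n<N. \<bar>f n\<bar> / g n)"
  have nonneg: "\<bar>f n\<bar> / g n \<ge> 0" for n using assms(2)[of n] by simp
  have S: "S \<ge> 0" unfolding S_def by (intro sum_nonneg nonneg)
  have "\<bar>f n\<bar> \<le> (c + S) * g n" for n
  proof (cases "n < N")
    case True
    have "\<bar>f n\<bar> / g n \<le> S" unfolding S_def
      using True nonneg by (intro member_le_sum) auto
    hence "\<bar>f n\<bar> / g n \<le> c + S" using c(1) by linarith
    thus ?thesis using assms(2)[of n] by (simp add: divide_le_eq)
  next
    case False
    have "\<bar>f n\<bar> \<le> c * g n" using N[of n] False assms(2)[of n] by simp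
    also have "\<dots> \<le> (c + S) * g n" using S assms(2)[of n] by (intro mult_right_mono) auto
    finally show ?thesis .
  qed
  thus ?thesis using c S by (intro that[of "c + S"]) auto
qed

text \<open>Strong induction for T_n <= M w_n: after division by n the recurrence bounds T_n by h_n
  + C M times the self-convolution of w, which is o(w) and so uses up only half of M.\<close>

lemma (in fast_growing) recurrence_dominated_pos:
  assumes rec: "\<And>n. real n * T n = (\<Sum>s=1..n. real s * h s * T (n - s))"
    and T: "T 0 = 1" "\<And>n. T n \<ge> 0" and h: "h \<in> O(w)" and pos: "\<And>n. w n > 0"
    and S: "(\<lambda>n. \<Sum>s=1..n-1. w s * w (n - s)) \<in> O(\<lambda>n. w (n - 1))"
  shows "T \<in> O(w)"
proof -
  obtain C where C: "C > 0" "\<And>n. \<bar>h n\<bar> \<le> C * w n"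
    using bigo_pos_uniform_bound[OF h pos] by blast
  have "(\<lambda>n. \<Sum>s=1..n-1. w s * w (n - s)) \<in> o(w)"
    by (rule landau_o.big_small_trans[OF S ratio])
  hence "eventually (\<lambda>n. norm (\<Sum>s=1..n-1. w s * w (n - s)) \<le> (1 / (2 * C)) * norm (w n)) sequentially"
    by (rule landau_o.smallD) (use C in simp)
  then obtain N where N: "\<And>n. n \<ge> N \<Longrightarrow> \<bar>\<Sum>s=1..n-1. w s * w (n - s)\<bar> \<le> (1 / (2 * C)) * \<bar>w n\<bar>"
    by (auto simp: eventually_at_top_linorder)
  \<comment> \<open>The sum covers n <= N; M >= 2 C lets C w_n, the bound for h_n, fit into the
    other half of M.\<close>
  define M where "M = 2 * C + (\<Sum>n\<le>N. T n / w n)"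
  have nonneg: "T n / w n \<ge> 0" for n using T(2)[of n] pos[of n] by simp
  have M: "M \<ge> 2 * C" unfolding M_def using nonneg by (simp add: sum_nonneg)
  have "T n \<le> M * w n" for n
  proof (induction n rule: less_induct)
    case (less n)
    show ?case
    proof (cases "n \<le> N")
      case True
      have "T n / w n \<le> (\<Sum>n\<le>N. T n / w n)"
        using True nonneg by (intro member_le_sum) auto
      hence "T n / w n \<le> M" unfolding M_def using C by linarith
      thus ?thesis using pos[of n] by (simp add: divide_le_eq)
    next
      case False
      hence n: "n \<ge> N" "n \<ge> 1" by auto
      \<comment> \<open>The term s = n is n h_n since \<open>T 0 = 1\<close>; in all others the
        index n - s < n is covered by the induction hypothesis.\<close>
      have "{1..n} = insert n {1..n-1}" using n by auto
      hence "real n * T n = real n * h n + (\<Sum>s=1..n-1. real s * h s * T (n - s))"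
        using rec[of n] T(1) n by simp
      also have "(\<Sum>s=1..n-1. real s * h s * T (n - s)) \<le> (\<Sum>s=1..n-1. real n * (C * M * (w s * w (n - s))))"
      proof (rule sum_mono)
        fix s assume s: "s \<in> {1..n-1}"
        have "\<bar>h s\<bar> * T (n - s) \<le> (C * w s) * (M * w (n - s))"
          using s less.IH[of "n - s"] C T(2)[of "n - s"] pos[of s] by (intro mult_mono) auto
        hence "real s * (\<bar>h s\<bar> * T (n - s)) \<le> real n * ((C * w s) * (M * w (n - s)))"
          using s T(2)[of "n - s"] by (intro mult_mono[of "real s" "real n"]) auto
        moreover have "real s * h s * T (n - s) \<le> real s * (\<bar>h s\<bar> * T (n - s))"
          using T(2)[of "n - s"] by (simp add: mult.assoc mult_left_mono mult_right_mono)
        ultimately show "real s * h s * T (n - s) \<le> real n * (C * M * (w s * w (n - s)))"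
          by (simp add: mult_ac)
      qed
      also have "\<dots> = real n * (C * M * (\<Sum>s=1..n-1. w s * w (n - s)))"
        by (simp add: sum_distrib_left)
      finally have "real n * T n \<le> real n * (h n + C * M * (\<Sum>s=1..n-1. w s * w (n - s)))"
        by (simp add: distrib_left)
      hence "T n \<le> h n + C * M * (\<Sum>s=1..n-1. w s * w (n - s))" using n by simp
      also have "\<dots> \<le> C * w n + C * M * (1 / (2 * C) * w n)"
        using C(1) order.trans[OF abs_ge_self C(2)[of n]] M N[OF n(1)] pos[of n]
        by (intro add_mono mult_left_mono) auto
      also have "\<dots> = C * w n + M / 2 * w n" using C by simp
      also have "\<dots> \<le> M / 2 * w n + M / 2 * w n"
        using M pos[of n] by (intro add_mono mult_right_mono) auto
      finally show ?thesis by simp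
    qed
  qed
  hence "norm (T n) \<le> M * norm (w n)" for n using T(2)[of n] pos[of n] by simp
  thus ?thesis by (intro bigoI always_eventually) auto
qed

text \<open>Reduces to the positive case by overwriting the initial values of w with 1, which
  changes no asymptotic statement.\<close>

lemma (in fast_growing) recurrence_dominated:
  assumes rec: "\<And>n. real n * T n = (\<Sum>s=1..n. real s * h s * T (n - s))"
    and T: "T 0 = 1" "\<And>n. T n \<ge> 0" and h: "h \<in> O(w)" and R: "R \<ge> 1"
    and S: "(\<lambda>n. \<Sum>s=R..n-R. w s * w (n - s)) \<in> O(\<lambda>n. w (n - R))"
  shows "T \<in> O(w)"
proof -
  obtain N0 where N0: "\<And>n. n \<ge> N0 \<Longrightarrow> w n > 0"
    using eventually_pos by (auto simp: eventually_at_top_linorder)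
  define N where "N = max N0 R"
  define w' where "w' = (\<lambda>n. if n \<ge> N then w n else 1)"
  have eq: "w' n = w n" if "n \<ge> N" for n using that by (simp add: w'_def)
  have ev: "eventually (\<lambda>n. w' n = w n) sequentially"
    using eventually_ge_at_top[of N] by eventually_elim (rule eq)
  have w': "w' \<in> O(w)" "w \<in> O(w')" "w' n > 0" for n
    using landau_o.big.in_cong[OF ev, of w] landau_o.big.cong[OF ev] N0
    by (auto simp: w'_def N_def)
  interpret w': fast_growing w'
    by (rule fast_growing_transfer[OF w'(1,2)]) (intro always_eventually allI w')
  \<comment> \<open>The cutoff goes from R up to N, where w and \<open>w'\<close> agree, and then
    down to 1 for \<open>w'\<close>; the bound is weakened from shift R to shift 1.\<close>
  have "(\<lambda>n. \<Sum>s=N..n-N. w s * w (n - s)) \<in> O(\<lambda>n. w (n - R))"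
    using S conv_middle_iff[of R N] by (simp add: N_def)
  also have "(\<lambda>n. w (n - R)) \<in> O(\<lambda>n. w' (n - 1))"
    using w'.bigo_shift0[OF w'(2), of 1 R] R by simp
  also have "(\<lambda>n. \<Sum>s=N..n-N. w s * w (n - s)) = (\<lambda>n. \<Sum>s=N..n-N. w' s * w' (n - s))"
    by (intro ext sum.cong) (auto simp: eq)
  finally have "(\<lambda>n. \<Sum>s=1..n-1. w' s * w' (n - s)) \<in> O(\<lambda>n. w' (n - 1))"
    using w'.conv_middle_iff[of 1 N] R by (simp add: N_def)
  moreover have "h \<in> O(w')" using h w'(2) by (rule landau_o.big_trans)
  ultimately have "T \<in> O(w')"
    using rec T w'(3) by (intro w'.recurrence_dominated_pos[of T h]) auto
  thus ?thesis using w'(1) by (rule landau_o.big_trans)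
qed

section \<open>Warlimont triples\<close>

text \<open>\<open>beta T\<close> is the coefficient sequence of the reciprocal power series of T.
  Both orders are recorded because expansions are inverted in both directions.\<close>

lemma beta_convolution:
  assumes "T 0 = 1"
  shows "(\<Sum>s\<le>n. beta T s * T (n - s)) = (if n = 0 then 1 else 0)"
    and "(\<Sum>s\<le>n. T s * beta T (n - s)) = (if n = 0 then 1 else 0)"
proof -
  show 1: "(\<Sum>s\<le>n. beta T s * T (n - s)) = (if n = 0 then 1 else 0)"
  proof (cases n)
    case 0
    thus ?thesis using assms by (simp add: beta.simps)
  next
    case (Suc m)
    have "(\<Sum>s\<le>n. beta T s * T (n - s)) = beta T n + (\<Sum>s=0..<n. beta T s * T (n - s))"
      using assms by (simp add: lessThan_Suc_atMost[symmetric] lessThan_atLeast0)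
    also have "\<dots> = 0" using Suc beta.simps[of T n] by simp
    finally show ?thesis using Suc by simp
  qed
  have "(\<Sum>s\<le>n. T s * beta T (n - s)) = (\<Sum>s\<le>n. beta T s * T (n - s))"
    by (rule sum.reindex_bij_witness[of _ "\<lambda>s. n - s" "\<lambda>s. n - s"]) auto
  thus "(\<Sum>s\<le>n. T s * beta T (n - s)) = (if n = 0 then 1 else 0)" using 1 by simp
qed

lemma bigo_diff_iff:
  fixes f g :: "nat \<Rightarrow> real"
  assumes "(\<lambda>n. f n - g n) \<in> O(G)"
  shows "f \<in> O(G) \<longleftrightarrow> g \<in> O(G)"
  using sum_in_bigo(1)[OF assms, of g] sum_in_bigo(2)[OF _ assms, of f] by auto

context
  fixes T t a :: "nat \<Rightarrow> real" and R :: nat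
  assumes W: "warlimont_triple T t a"
    and ln_a: "(\<lambda>n. ln (a n)) \<in> O(\<lambda>n. real n)"
    and R: "R \<ge> 1"
begin

abbreviation (input) "h \<equiv> log_coeff t a"

lemma T_0: "T 0 = 1" and T_nonneg: "T n \<ge> 0" and a1_pos: "a 1 > 0"
  and t_nonneg: "m \<ge> 1 \<Longrightarrow> t m \<ge> 0"
  using W by (auto simp: warlimont_triple_def)

lemma eventually_t_pos: "eventually (\<lambda>n. t n > 0) sequentially"
proof -
  have "finite {m. m \<ge> 1 \<and> \<not> t m > 0}" using W by (simp add: warlimont_triple_def)
  hence "eventually (\<lambda>m. m \<notin> {m. m \<ge> 1 \<and> \<not> t m > 0}) sequentially"
    by (simp only: eventually_cofinite[symmetric] cofinite_eq_sequentially[symmetric]) (simp add: eventually_cofinite)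
  thus ?thesis using eventually_ge_at_top[of 1] by eventually_elim auto
qed

lemma eventually_T_pos: "eventually (\<lambda>n. T n > 0) sequentially"
  using eventually_t_pos eventually_ge_at_top[of 1]
proof eventually_elim
  case (elim n)
  have "0 < a 1 * t n" using elim a1_pos by simp
  also have "\<dots> \<le> T n" using a1_t_le_T[OF W] elim by simp
  finally show ?case .
qed

lemma T_fast_growing: "(\<lambda>n. T (n - 1)) \<in> o(T) \<Longrightarrow> fast_growing T"
  using eventually_T_pos by unfold_locales

lemma t_fast_growing: "(\<lambda>n. t (n - 1)) \<in> o(t) \<Longrightarrow> fast_growing t"
  using eventually_t_pos by unfold_locales

lemma t_in_O_T: "t \<in> O(T)"
proof (rule bigoI)
  show "eventually (\<lambda>n. norm (t n) \<le> 1 / a 1 * norm (T n)) sequentially"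
    using eventually_ge_at_top[of 1]
  proof eventually_elim
    case (elim n)
    thus ?case using a1_t_le_T[OF W elim] T_nonneg[of n] t_nonneg[of n] a1_pos
      by (simp add: field_simps)
  qed
qed

text \<open>Applied with w = T and k = 1 / a_1, and with w = t and k = 1. The bound on t is required
  from m = 1 on because the error involves all small indices.\<close>

lemma log_coeff_diff_bigo:
  assumes w: "fast_growing w" and le: "\<And>m. m \<ge> 1 \<Longrightarrow> t m \<le> k * w m"
  and k: "k \<ge> 0"
  shows "(\<lambda>n. h n - a 1 * t n) \<in> O(\<lambda>n. w (n - R))"
proof -
  obtain L where L: "L \<ge> 1" "\<And>k. \<bar>pow_coeff a k\<bar> \<le> L ^ k"
    using pow_coeff_exp_bound[OF W ln_a] by blast
  have "(\<lambda>n. h n - a 1 * t n) \<in> O(\<lambda>n. L ^ n * (\<Sum>m=1..n div 2. w m))"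
  proof (rule bigoI)
    show "eventually (\<lambda>n. norm (h n - a 1 * t n) \<le> k * norm (L ^ n * (\<Sum>m=1..n div 2. w m))) sequentially"
      using eventually_ge_at_top[of 1]
    proof eventually_elim
      case (elim n)
      have "\<bar>h n - a 1 * t n\<bar> \<le> L ^ n * (\<Sum>m=1..n div 2. t m)"
        by (rule log_coeff_diff_le[OF W L(2,1) elim])
      also have "\<dots> \<le> L ^ n * (\<Sum>m=1..n div 2. k * w m)"
        using L le by (intro mult_left_mono sum_mono) auto
      also have "\<dots> = k * (L ^ n * (\<Sum>m=1..n div 2. w m))"
        by (simp add: sum_distrib_left mult_ac)
      also have "\<dots> \<le> k * \<bar>L ^ n * (\<Sum>m=1..n div 2. w m)\<bar>"
        using k by (intro mult_left_mono) auto
      finally show ?case by simp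
    qed
  qed
  also have "(\<lambda>n. L ^ n * (\<Sum>m=1..n div 2. w m)) \<in> O(\<lambda>n. w (n - R))"
    by (rule fast_growing.exp_times_half_sum_bigo[OF w])
  finally show ?thesis .
qed

lemma t_le_T: "m \<ge> 1 \<Longrightarrow> t m \<le> 1 / a 1 * T m"
  using a1_t_le_T[OF W, of m] a1_pos by (simp add: field_simps)

lemmas log_coeff_diff_bigo_T = log_coeff_diff_bigo[OF _ t_le_T divide_nonneg_pos[OF zero_le_one a1_pos]]

lemma log_coeff_diff_bigo_t: "fast_growing t \<Longrightarrow> (\<lambda>n. h n - a 1 * t n) \<in> O(\<lambda>n. t (n - R))"
  by (rule log_coeff_diff_bigo[of t 1]) auto

text \<open>The first two are the errors in 2) and 3); the last two arise from them by replacing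
  \<open>a 1 * t\<close> with \<open>h\<close>.\<close>

abbreviation (input) "t_remainder n \<equiv> a 1 * t n - (\<Sum>s=0..R-1. beta T s * T (n - s))"
abbreviation (input) "T_remainder n \<equiv> T n - a 1 * (\<Sum>s=0..R-1. T s * t (n - s))"
abbreviation (input) "h_log_remainder n \<equiv> h n - (\<Sum>s<R. beta T s * T (n - s))"
abbreviation (input) "T_log_remainder n \<equiv> T n - (\<Sum>s<R. T s * h (n - s))"

lemma lessThan_R: "{0..R-1} = {..<R}"
  using R by auto

section \<open>Equivalence of the remainders at a common scale w\<close>

context
  fixes w :: "nat \<Rightarrow> real"
  assumes w: "fast_growing w"
    and diff: "(\<lambda>n. h n - a 1 * t n) \<in> O(\<lambda>n. w (n - R))"
begin

interpretation fast_growing w by (rule w)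

lemma h_bigo_iff: "h \<in> O(w) \<longleftrightarrow> t \<in> O(w)"
proof -
  have "(\<lambda>n. h n - a 1 * t n) \<in> O(\<lambda>n. w (n - 0))"
    by (rule bigo_weaken[OF diff]) simp
  hence "h \<in> O(w) \<longleftrightarrow> (\<lambda>n. a 1 * t n) \<in> O(w)" by (intro bigo_diff_iff) simp
  thus ?thesis using a1_pos by simp
qed

lemma diff_shift1: "(\<lambda>n. h n - a 1 * t n) \<in> O(\<lambda>n. w (n - 1))"
  by (rule bigo_weaken[OF diff R])

lemma t_remainder_iff:
  "t_remainder \<in> O(\<lambda>n. w (n - R)) \<longleftrightarrow> h_log_remainder \<in> O(\<lambda>n. w (n - R))"
proof (rule bigo_diff_iff[symmetric])
  show "(\<lambda>n. h_log_remainder n - t_remainder n) \<in> O(\<lambda>n. w (n - R))"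
    unfolding lessThan_R using diff by simp
qed

lemma T_remainder_iff:
  "T_remainder \<in> O(\<lambda>n. w (n - R)) \<longleftrightarrow> T_log_remainder \<in> O(\<lambda>n. w (n - R))"
proof (rule bigo_diff_iff)
  have "T_remainder n - T_log_remainder n = (\<Sum>s<R. T s * (h (n - s) - a 1 * t (n - s)))" for n
    unfolding lessThan_R by (simp add: algebra_simps sum_subtractf sum_distrib_left)
  moreover have "(\<lambda>n. \<Sum>s<R. T s * (h (n - s) - a 1 * t (n - s))) \<in> O(\<lambda>n. w (n - R))"
    using bigo_shift[OF diff, of R] by (intro big_sum_in_bigo landau_o.big.mult_in_1) auto
  ultimately show "(\<lambda>n. T_remainder n - T_log_remainder n) \<in> O(\<lambda>n. w (n - R))" by simp
qed

text \<open>Truncated inversion with T and \<open>beta T\<close> in either role.\<close>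

lemma log_remainder_iff:
  assumes "T \<in> O(w)" "h \<in> O(w)"
  shows "T_log_remainder \<in> O(\<lambda>n. w (n - R)) \<longleftrightarrow> h_log_remainder \<in> O(\<lambda>n. w (n - R))"
  using truncated_inverse[OF assms(2) beta_convolution(1)[of T] R, of T]
    truncated_inverse[OF assms(1) beta_convolution(2)[of T] R, of h] T_0 by auto

lemma T_log_remainder_of_conv:
  assumes "T \<in> O(w)" "h \<in> O(w)"
    and "(\<lambda>n. \<Sum>s=R..n-R. w s * w (n - s)) \<in> O(\<lambda>n. w (n - R))"
  shows "T_log_remainder \<in> O(\<lambda>n. w (n - R))"
  using weighted_conv_bigo[OF assms(2,1,3)]
  by (simp only: remainder_bigo_iff[OF logderiv_recurrence[OF W] assms(2,1)])

lemma conv_of_T_log_remainder: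
  assumes "T \<in> O(w)" "w \<in> O(T)" "h \<in> O(w)" "w \<in> O(h)" "eventually (\<lambda>n. h n > 0) sequentially"
    and "T_log_remainder \<in> O(\<lambda>n. w (n - R))"
  shows "(\<lambda>n. \<Sum>s=R..n-R. w s * w (n - s)) \<in> O(\<lambda>n. w (n - R))"
proof (rule conv_bigo_of_weighted)
  show "eventually (\<lambda>n. h n \<ge> 0) sequentially" "eventually (\<lambda>n. T n \<ge> 0) sequentially"
    using assms(5) T_nonneg by (auto elim: eventually_mono)
  show "(\<lambda>n. \<Sum>s=R..n-R. real s * h s * T (n - s)) \<in> O(\<lambda>n. real n * w (n - R))"
    using assms(6) by (simp only: remainder_bigo_iff[OF logderiv_recurrence[OF W] assms(3,1)])
qed fact+

end

section \<open>The implications between the four statements\<close>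

lemma h_in_O_T:
  assumes "fast_growing T"
  shows "h \<in> O(T)"
  using h_bigo_iff[OF assms log_coeff_diff_bigo_T[OF assms]] t_in_O_T by simp

lemma h_in_O_t:
  assumes "fast_growing t"
  shows "h \<in> O(t)"
  using h_bigo_iff[OF assms log_coeff_diff_bigo_t[OF assms]] by simp

text \<open>1) implies 2), at the scale w = T.\<close>

lemma conv_T_imp_t_remainder:
  assumes w: "fast_growing T"
    and S: "(\<lambda>n. \<Sum>s=R..n-R. T s * T (n - s)) \<in> O(\<lambda>n. T (n - R))"
  shows "t_remainder \<in> O(\<lambda>n. T (n - R))"
proof -
  note d = log_coeff_diff_bigo_T[OF w]
  have "T_log_remainder \<in> O(\<lambda>n. T (n - R))"
    by (rule T_log_remainder_of_conv[OF w d landau_o.big_refl h_in_O_T[OF w] S])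
  thus ?thesis
    by (simp only: t_remainder_iff[OF w d] log_remainder_iff[OF w d landau_o.big_refl h_in_O_T[OF w]])
qed

text \<open>2) implies 1) and 3). The leading term of the expansion makes h, and hence a_1 t,
  asymptotic to T, so all three are comparable.\<close>

lemma t_remainder_imp:
  assumes w: "fast_growing T" and rem: "t_remainder \<in> O(\<lambda>n. T (n - R))"
  shows "(\<lambda>n. \<Sum>s=R..n-R. T s * T (n - s)) \<in> O(\<lambda>n. T (n - R))"
    and "fast_growing t" and "T_remainder \<in> O(\<lambda>n. t (n - R))"
proof -
  interpret fast_growing T by (rule w)
  note d = log_coeff_diff_bigo_T[OF w]
  note h = h_in_O_T[OF w]
  have f: "h_log_remainder \<in> O(\<lambda>n. T (n - R))"
    using rem by (simp only: t_remainder_iff[OF w d])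
  hence e: "T_log_remainder \<in> O(\<lambda>n. T (n - R))"
    by (simp only: log_remainder_iff[OF w d landau_o.big_refl h])
  have hT: "(\<lambda>n. h n - T n) \<in> O(\<lambda>n. T (n - 1))"
    by (rule expansion_leading_term[OF landau_o.big_refl R _ f]) (simp add: beta.simps)
  hence "(\<lambda>n. h n - 1 * T n) \<in> O(\<lambda>n. T (n - 1))" by simp
  note h_cmp = comparable_of_leading_term[OF this zero_less_one]
  show "(\<lambda>n. \<Sum>s=R..n-R. T s * T (n - s)) \<in> O(\<lambda>n. T (n - R))"
    by (rule conv_of_T_log_remainder[OF w d _ _ h_cmp e]) auto
  have "(\<lambda>n. a 1 * (t n - 1 / a 1 * T n)) \<in> O(\<lambda>n. T (n - 1))"
    using sum_in_bigo(2)[OF hT diff_shift1[OF w d]] a1_pos by (simp add: right_diff_distrib)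
  hence "(\<lambda>n. t n - 1 / a 1 * T n) \<in> O(\<lambda>n. T (n - 1))"
    using a1_pos by simp
  note t_cmp = comparable_of_leading_term[OF this divide_pos_pos[OF zero_less_one a1_pos]]
  show t: "fast_growing t" by (rule fast_growing_transfer[OF t_cmp])
  \<comment> \<open>The scale of the error changes here from T to t.\<close>
  have "(\<lambda>n. T (n - R)) \<in> O(\<lambda>n. t (n - R))"
    by (rule fast_growing.bigo_shift0[OF t t_cmp(2) order.refl])
  with e have "T_log_remainder \<in> O(\<lambda>n. t (n - R))" by (rule landau_o.big_trans)
  thus "T_remainder \<in> O(\<lambda>n. t (n - R))"
    by (simp only: T_remainder_iff[OF t log_coeff_diff_bigo_t[OF t]])
qed

text \<open>3) implies 2) and 4), at the scale w = t; as \<open>T 0 = 1\<close>, the leading term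
  makes T asymptotic to a_1 t.\<close>

lemma T_remainder_imp:
  assumes w: "fast_growing t" and rem: "T_remainder \<in> O(\<lambda>n. t (n - R))"
  shows "fast_growing T" and "t_remainder \<in> O(\<lambda>n. T (n - R))"
    and "(\<lambda>n. \<Sum>s=R..n-R. t s * t (n - s)) \<in> O(\<lambda>n. t (n - R))"
proof -
  interpret fast_growing t by (rule w)
  note d = log_coeff_diff_bigo_t[OF w]
  note h = h_in_O_t[OF w]
  have e: "T_log_remainder \<in> O(\<lambda>n. t (n - R))"
    using rem by (simp only: T_remainder_iff[OF w d])
  have "(\<lambda>n. T n - h n) \<in> O(\<lambda>n. t (n - 1))"
    by (rule expansion_leading_term[OF h R T_0 e])
  from sum_in_bigo(1)[OF this diff_shift1[OF w d]]
  have "(\<lambda>n. T n - a 1 * t n) \<in> O(\<lambda>n. t (n - 1))" by simp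
  note T_cmp = comparable_of_leading_term[OF this a1_pos]
  note h_cmp = comparable_of_leading_term[OF diff_shift1[OF w d] a1_pos]
  show T: "fast_growing T" by (rule fast_growing_transfer[OF T_cmp])
  show "(\<lambda>n. \<Sum>s=R..n-R. t s * t (n - s)) \<in> O(\<lambda>n. t (n - R))"
    by (rule conv_of_T_log_remainder[OF w d T_cmp(1,2) h_cmp e])
  have "h_log_remainder \<in> O(\<lambda>n. t (n - R))"
    using e by (simp only: log_remainder_iff[OF w d T_cmp(1) h])
  also have "(\<lambda>n. t (n - R)) \<in> O(\<lambda>n. T (n - R))"
    by (rule fast_growing.bigo_shift0[OF T T_cmp(2) order.refl])
  finally show "t_remainder \<in> O(\<lambda>n. T (n - R))"
    by (simp only: t_remainder_iff[OF T log_coeff_diff_bigo_T[OF T]])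
qed

text \<open>4) implies 3). Here the size of T is not given in advance, and the a priori bound from
  the recurrence supplies T = O(t).\<close>

lemma conv_t_imp_T_remainder:
  assumes w: "fast_growing t"
    and S: "(\<lambda>n. \<Sum>s=R..n-R. t s * t (n - s)) \<in> O(\<lambda>n. t (n - R))"
  shows "T_remainder \<in> O(\<lambda>n. t (n - R))"
proof -
  note d = log_coeff_diff_bigo_t[OF w]
  have "T \<in> O(t)"
    by (rule fast_growing.recurrence_dominated[OF w logderiv_recurrence[OF W] T_0 T_nonneg h_in_O_t[OF w] R S])
  from T_log_remainder_of_conv[OF w d this h_in_O_t[OF w] S] show ?thesis
    by (simp only: T_remainder_iff[OF w d])
qed

end

(* Where a n = 0, the convention ln 0 = 0 makes the hypothesis on ln (a n) void. *)
theorem theorem5: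
  fixes T t a :: "nat \<Rightarrow> real" and R :: nat
  assumes "warlimont_triple T t a"
    and "(\<lambda>n. ln (a n)) \<in> O(\<lambda>n. real n)"
    and "R \<ge> 1"
  shows
    "let
       P1 = (\<lambda>n. T (n - 1)) \<in> o(T) \<and>
            (\<lambda>n. \<Sum>s=R..n-R. T s * T (n - s)) \<in> O(\<lambda>n. T (n - R));
       P2 = (\<lambda>n. T (n - 1)) \<in> o(T) \<and>
            (\<lambda>n. a 1 * t n - (\<Sum>s=0..R-1. beta T s * T (n - s))) \<in> O(\<lambda>n. T (n - R));
       P3 = (\<lambda>n. t (n - 1)) \<in> o(t) \<and>
            (\<lambda>n. T n - a 1 * (\<Sum>s=0..R-1. T s * t (n - s))) \<in> O(\<lambda>n. t (n - R));
       P4 = (\<lambda>n. t (n - 1)) \<in> o(t) \<and>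
            (\<lambda>n. \<Sum>s=R..n-R. t s * t (n - s)) \<in> O(\<lambda>n. t (n - R))
     in (P1 \<longleftrightarrow> P2) \<and> (P2 \<longleftrightarrow> P3) \<and> (P3 \<longleftrightarrow> P4)"
  proof -
  note W = assms
  have 12: "fast_growing T \<Longrightarrow> (\<lambda>n. \<Sum>s=R..n-R. T s * T (n - s)) \<in> O(\<lambda>n. T (n - R)) \<longleftrightarrow>
      (\<lambda>n. a 1 * t n - (\<Sum>s=0..R-1. beta T s * T (n - s))) \<in> O(\<lambda>n. T (n - R))"
    using conv_T_imp_t_remainder[OF W] t_remainder_imp(1)[OF W] by blast
  have 34: "fast_growing t \<Longrightarrow>
      (\<lambda>n. T n - a 1 * (\<Sum>s=0..R-1. T s * t (n - s))) \<in> O(\<lambda>n. t (n - R)) \<longleftrightarrow>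
      (\<lambda>n. \<Sum>s=R..n-R. t s * t (n - s)) \<in> O(\<lambda>n. t (n - R))"
    using conv_t_imp_T_remainder[OF W] T_remainder_imp(3)[OF W] by blast
  have 23: "fast_growing T \<and>
      (\<lambda>n. a 1 * t n - (\<Sum>s=0..R-1. beta T s * T (n - s))) \<in> O(\<lambda>n. T (n - R)) \<longleftrightarrow>
      fast_growing t \<and>
      (\<lambda>n. T n - a 1 * (\<Sum>s=0..R-1. T s * t (n - s))) \<in> O(\<lambda>n. t (n - R))"
    using t_remainder_imp(2,3)[OF W] T_remainder_imp(1,2)[OF W] by blast
  \<comment> \<open>Eventual positivity holds for every Warlimont triple, so each ratio condition is
    the whole of \<open>fast_growing\<close>.\<close>
  have ratio: "(\<lambda>n. T (n - 1)) \<in> o(T) \<longleftrightarrow> fast_growing T" "(\<lambda>n. t (n - 1)) \<in> o(t) \<longleftrightarrow> fast_growing t"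
    using T_fast_growing[OF W] t_fast_growing[OF W] fast_growing.ratio by blast+
  show ?thesis unfolding Let_def ratio using 12 23 34 by blast
qed

end
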